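(* Let $G(V,E)$ be a graph on $n$ vertices. Then a box representation $\mathcal{B}$ of $G$ with $|\mathcal{B}|\le t\cdot box(G)$, where $t=O\left(\frac{n\sqrt{\log\log n}}{\sqrt{\log n}}\right)$, can be computed in polynomial time. Further, a cube representation $\mathcal{C}$ of $G$ with $|\mathcal{C}|\le t'\cdot cub(G)$, where $t'=O\left(\frac{n(\log\log n)^{3/2}}{\sqrt{\log n}}\right)$, can also be computed in polynomial time.
   Context: All graphs are finite and simple. A graph is an interval graph (resp. unit interval graph) if one can assign to each vertex a closed interval (resp. closed interval of unit length) of $\mathbb{R}$ such that two distinct vertices are adjacent iff their intervals intersect. For a graph $G(V,E)$, a box (resp. cube) representation of $G$ of dimension $k$ is a collection $\{I_1,\dots,I_k\}$ of interval (resp. unit interval) graphs on vertex set $V$ with $E(G)=E(I_1)\cap\cdots\cap E(I_k)$; $|\mathcal{B}|$ denotes the dimension of a representation $\mathcal{B}$. The boxicity $box(G)$ (resp. cubicity $cub(G)$) of an incomplete graph $G$ is the minimum $k$ such that $G$ has a box (resp. cube) representation of dimension $k$; for a complete graph both are $0$. *)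

theory Defs
  imports Complex_Main "HOL-Library.Landau_Symbols" "HOL-Computational_Algebra.Polynomial"
begin

type_synonym 'a graph = "'a set \<times> 'a set set"

abbreviation verts :: "'a graph \<Rightarrow> 'a set" where "verts \<equiv> fst"
abbreviation edges :: "'a graph \<Rightarrow> 'a set set" where "edges \<equiv> snd"

definition all_edges :: "'a set \<Rightarrow> 'a set set" where
  "all_edges V = {e. e \<subseteq> V \<and> card e = 2}"

definition simple_graph :: "'a graph \<Rightarrow> bool" where
  "simple_graph G \<longleftrightarrow> finite (verts G) \<and> edges G \<subseteq> all_edges (verts G)"

definition complete_graph :: "'a graph \<Rightarrow> bool" where
  "complete_graph G \<longleftrightarrow> simple_graph G \<and> edges G = all_edges (verts G)"

definition interval_graph :: "'a graph \<Rightarrow> bool" where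
  "interval_graph G \<longleftrightarrow> simple_graph G \<and>
     (\<exists>l r :: 'a \<Rightarrow> real. (\<forall>v\<in>verts G. l v \<le> r v) \<and>
        (\<forall>u\<in>verts G. \<forall>v\<in>verts G. u \<noteq> v \<longrightarrow>
           ({u, v} \<in> edges G \<longleftrightarrow> {l u..r u} \<inter> {l v..r v} \<noteq> {})))"

definition unit_interval_graph :: "'a graph \<Rightarrow> bool" where
  "unit_interval_graph G \<longleftrightarrow> simple_graph G \<and>
     (\<exists>l :: 'a \<Rightarrow> real.
        (\<forall>u\<in>verts G. \<forall>v\<in>verts G. u \<noteq> v \<longrightarrow>
           ({u, v} \<in> edges G \<longleftrightarrow> {l u..l u + 1} \<inter> {l v..l v + 1} \<noteq> {})))"

text \<open>A representation is a list of graphs, its dimension being the length of the list.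
  Intersecting with \<^const>\<open>all_edges\<close> only matters for the empty list, whose intersection
  is thereby the complete graph; this matches boxicity and cubicity 0 for complete graphs.\<close>

definition box_representation :: "'a graph \<Rightarrow> 'a graph list \<Rightarrow> bool" where
  "box_representation G B \<longleftrightarrow>
     (\<forall>I\<in>set B. verts I = verts G \<and> interval_graph I) \<and>
     edges G = all_edges (verts G) \<inter> (\<Inter>I\<in>set B. edges I)"

definition cube_representation :: "'a graph \<Rightarrow> 'a graph list \<Rightarrow> bool" where
  "cube_representation G B \<longleftrightarrow>
     (\<forall>I\<in>set B. verts I = verts G \<and> unit_interval_graph I) \<and>
     edges G = all_edges (verts G) \<inter> (\<Inter>I\<in>set B. edges I)"

definition boxicity :: "'a graph \<Rightarrow> nat" where
  "boxicity G = (if complete_graph G then 0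
     else (LEAST k. \<exists>B. box_representation G B \<and> length B = k))"

definition cubicity :: "'a graph \<Rightarrow> nat" where
  "cubicity G = (if complete_graph G then 0
     else (LEAST k. \<exists>C. cube_representation G C \<and> length C = k))"


text \<open>Polynomial time is measured on a random access machine with structured control flow.
  The memory consists of banks of cells holding natural numbers; a program addresses a bank by a
  literal (so it uses finitely many banks) and a cell of the bank by a computed index. The only
  arithmetic operations are addition and truncated subtraction. As there is no multiplication,
  the bit length of every value grows by at most a constant (depending on the program) per step,
  so the unit-cost measure below is polynomially related to Turing machine time. Charging one
  unit for evaluating an expression is harmless, since a program contains only finitely many
  expressions.\<close>

type_synonym memory = "nat \<Rightarrow> nat \<Rightarrow> nat"

datatype expr =
    Const nat
  | Cell nat expr
  | Plus expr expr
  | Minus expr expr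

fun eval_expr :: "expr \<Rightarrow> memory \<Rightarrow> nat" where
  "eval_expr (Const k) m = k"
| "eval_expr (Cell a e) m = m a (eval_expr e m)"
| "eval_expr (Plus e1 e2) m = eval_expr e1 m + eval_expr e2 m"
| "eval_expr (Minus e1 e2) m = eval_expr e1 m - eval_expr e2 m"

datatype prog =
    Skip
  | Assign nat expr expr
  | Seq prog prog
  | If expr prog prog
  | While expr prog

text \<open>\<open>exec c m k m'\<close>: started in memory \<open>m\<close>, the program \<open>c\<close> halts after \<open>k\<close> steps in
  memory \<open>m'\<close>. Tests succeed on nonzero values.\<close>

inductive exec :: "prog \<Rightarrow> memory \<Rightarrow> nat \<Rightarrow> memory \<Rightarrow> bool" where
  Skip: "exec Skip m 1 m"
| Assign: "exec (Assign a i e) m 1 (m(a := (m a)(eval_expr i m := eval_expr e m)))"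
| Seq: "\<lbrakk>exec c1 m k1 m1; exec c2 m1 k2 m2\<rbrakk> \<Longrightarrow> exec (Seq c1 c2) m (k1 + k2) m2"
| IfTrue: "\<lbrakk>eval_expr b m \<noteq> 0; exec c1 m k m'\<rbrakk> \<Longrightarrow> exec (If b c1 c2) m (k + 1) m'"
| IfFalse: "\<lbrakk>eval_expr b m = 0; exec c2 m k m'\<rbrakk> \<Longrightarrow> exec (If b c1 c2) m (k + 1) m'"
| WhileFalse: "eval_expr b m = 0 \<Longrightarrow> exec (While b c) m 1 m"
| WhileTrue: "\<lbrakk>eval_expr b m \<noteq> 0; exec c m k1 m1; exec (While b c) m1 k2 m2\<rbrakk>
     \<Longrightarrow> exec (While b c) m (k1 + k2 + 1) m2"

inductive_cases exec_SkipE: "exec Skip m k m'"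
inductive_cases exec_AssignE: "exec (Assign a i e) m k m'"
inductive_cases exec_SeqE: "exec (Seq c1 c2) m k m'"
inductive_cases exec_IfE: "exec (If b c1 c2) m k m'"
inductive_cases exec_WhileE: "exec (While b c) m k m'"

lemma exec_deterministic:
  "exec c m k m' \<Longrightarrow> exec c m l m'' \<Longrightarrow> k = l \<and> m' = m''"
proof (induction arbitrary: l m'' rule: exec.induct)
  case (Skip m)
  from Skip.prems show ?case by (rule exec_SkipE) simp
next
  case (Assign a i e m)
  from Assign.prems show ?case by (rule exec_AssignE) simp
next
  case (Seq c1 m k1 m1 c2 k2 m2)
  from Seq.prems show ?case by (rule exec_SeqE) (metis Seq.IH)
next
  case (IfTrue b m c1 k m' c2)
  from IfTrue.prems show ?case by (rule exec_IfE) (use IfTrue.hyps(1) in \<open>simp_all, metis IfTrue.IH\<close>)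
next
  case (IfFalse b m c2 k m' c1)
  from IfFalse.prems show ?case by (rule exec_IfE) (use IfFalse.hyps(1) in \<open>simp_all, metis IfFalse.IH\<close>)
next
  case (WhileFalse b m c)
  from WhileFalse.prems show ?case by (rule exec_WhileE) (use WhileFalse.hyps in simp_all)
next
  case (WhileTrue b m c k1 m1 k2 m2)
  from WhileTrue.prems show ?case
    by (rule exec_WhileE) (use WhileTrue.hyps(1) in \<open>simp_all, metis WhileTrue.IH\<close>)
qed

text \<open>Words are passed in bank 0, one bit per cell, with their length in cell 0 of bank 1.\<close>

definition input_memory :: "bool list \<Rightarrow> memory" where
  "input_memory w = (\<lambda>a i.
     if a = 0 \<and> i < length w then of_bool (w ! i)
     else if a = 1 \<and> i = 0 then length w
     else 0)"

definition holds_output :: "memory \<Rightarrow> bool list \<Rightarrow> bool" where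
  "holds_output m w \<longleftrightarrow> m 1 0 = length w \<and> (\<forall>i<length w. m 0 i = of_bool (w ! i))"

text \<open>The length of the output is included in the running time, so that a short computation
  cannot declare an output of exponential length.\<close>

definition poly_time_computable_on ::
    "'a set \<Rightarrow> ('a \<Rightarrow> bool list) \<Rightarrow> ('b \<Rightarrow> bool list) \<Rightarrow> ('a \<Rightarrow> 'b) \<Rightarrow> bool" where
  "poly_time_computable_on D enc_in enc_out f \<longleftrightarrow>
     (\<exists>(c :: prog) (p :: nat poly). \<forall>x\<in>D. \<exists>k m.
        exec c (input_memory (enc_in x)) k m \<and>
        holds_output m (enc_out (f x)) \<and>
        k + length (enc_out (f x)) \<le> poly p (length (enc_in x)))"

text \<open>For computations the vertices are \<open>0, \<dots>, n - 1\<close>.\<close>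

definition labelled_graphs :: "nat graph set" where
  "labelled_graphs = {G. simple_graph G \<and> (\<exists>n. verts G = {..<n})}"

text \<open>The number \<open>n\<close> of vertices in unary, followed by the adjacency matrix in row-major order.\<close>

definition encode_graph :: "nat graph \<Rightarrow> bool list" where
  "encode_graph G = (let n = card (verts G) in
     replicate n True @ [False] @ concat (map (\<lambda>i. map (\<lambda>j. {i, j} \<in> edges G) [0..<n]) [0..<n]))"

definition encode_graphs :: "nat graph list \<Rightarrow> bool list" where
  "encode_graphs Gs = replicate (length Gs) True @ [False] @ concat (map encode_graph Gs)"

end

theory Submission imports Defs begin

text \<open>A height function \<open>h\<close> on the vertices separates \<open>u\<close> from \<open>v\<close> if \<open>u\<close> is higher than every
  vertex of the closed neighbourhood of \<open>v\<close>. Deleting the separated pairs from the complete graph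
  leaves an interval supergraph of \<open>G\<close>, because \<open>v\<close> can be given the interval from \<open>h v\<close> to the
  greatest height in its closed neighbourhood. If in addition \<open>v\<close> is required to have height 0, the
  deleted pairs form a bipartite chain graph and the supergraph is a unit interval graph.

  Conversely, fix a block \<open>W\<close> of \<open>k\<close> vertices and rank it by left or by right endpoints in one
  interval graph of a representation of \<open>G\<close>, giving height 0 to all vertices outside \<open>W\<close>. The two
  height functions separate every pair with a vertex in \<open>W\<close> that the interval graph does not join.
  So \<open>2 box(G)\<close> height functions with values at most \<open>k\<close> deal with all non-edges meeting \<open>W\<close>. For
  cubes, \<open>W\<close> is first split by the binary digits of the vertices, which costs a factor
  \<open>O(log k)\<close>. Moreover \<open>k\<close> indicator functions always suffice, so an optimal family is found among
  at most \<open>(k + 1) ^ (k * k + 1)\<close> candidates. This is polynomial in \<open>n\<close> for the largest \<open>k\<close> with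
  \<open>(k + 1) ^ (k * k) \<le> n\<close>, which is of order \<open>sqrt (log n / log log n)\<close>, and the \<open>n / k\<close> blocks
  account for the approximation factor.\<close>

section \<open>Height functions and interval graphs\<close>

text \<open>Separation refers only to neighbourhoods in \<open>G\<close>, so the graph of any height
  function contains \<open>G\<close>. A list of height functions is therefore a representation as
  soon as it separates every non-edge, and this can be tested without any interval model; that is
  why exhaustive search over small lists is sound. Separation is directed: the vertex of the block
  is the higher one. Hence all vertices outside the block can stay at height 0, and a function on
  \<open>k\<close> vertices with values at most \<open>k\<close> costs \<open>k\<close> digits in
  base \<open>k + 1\<close>. With at most \<open>k\<close> functions this gives the exponent
  \<open>k * k\<close>. For cubes the lower vertex must have height 0, so a ranking of the whole
  block separates no two of its members; ranking only the vertices that agree with \<open>u\<close>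
  in a binary digit in which \<open>v\<close> differs repairs this. The machine has neither
  multiplication nor division, so the search never decodes a number: it keeps the digits in memory,
  counts upwards like an odometer and stops at the first success, which is the least code.\<close>

definition separates :: "bool \<Rightarrow> 'a graph \<Rightarrow> ('a \<Rightarrow> nat) \<Rightarrow> 'a \<Rightarrow> 'a \<Rightarrow> bool" where
  "separates c G h u v \<longleftrightarrow>
     (\<forall>w\<in>verts G. w = v \<or> {w, v} \<in> edges G \<longrightarrow> h w < h u) \<and> (c \<longrightarrow> h v = 0)"

definition height_graph :: "bool \<Rightarrow> 'a graph \<Rightarrow> ('a \<Rightarrow> nat) \<Rightarrow> 'a graph" where
  "height_graph c G h = (verts G, {{u, v} | u v. u \<in> verts G \<and> v \<in> verts G \<and> u \<noteq> v \<and>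
     \<not> separates c G h u v \<and> \<not> separates c G h v u})"

lemma verts_height_graph [simp]: "verts (height_graph c G h) = verts G"
  by (simp add: height_graph_def)

lemma edge_height_graph_iff:
  assumes "u \<in> verts G" "v \<in> verts G"
  shows "{u, v} \<in> edges (height_graph c G h) \<longleftrightarrow>
    u \<noteq> v \<and> \<not> separates c G h u v \<and> \<not> separates c G h v u"
  using assms unfolding height_graph_def by (auto simp: doubleton_eq_iff)

lemma simple_height_graph:
  assumes "simple_graph G"
  shows "simple_graph (height_graph c G h)"
  using assms unfolding simple_graph_def height_graph_def all_edges_def by auto

text \<open>If \<open>u\<close> is adjacent to \<open>v\<close>, it lies in the closed neighbourhood
  of \<open>v\<close> and would have to be higher than itself. This holds for every
  \<open>h\<close>, so only missing separations can make a family fail.\<close>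

lemma edges_subset_height_graph:
  assumes "simple_graph G"
  shows "edges G \<subseteq> edges (height_graph c G h)"
proof
  fix e assume e: "e \<in> edges G"
  then have "e \<subseteq> verts G" "card e = 2"
    using assms by (auto simp: simple_graph_def all_edges_def)
  then obtain u v where uv: "e = {u, v}" "u \<noteq> v" "u \<in> verts G" "v \<in> verts G"
    by (auto simp: card_2_iff)
  then have "{v, u} \<in> edges G" "{u, v} \<in> edges G" using e by (simp_all add: insert_commute)
  then have "\<not> separates c G h u v \<and> \<not> separates c G h v u"
    using uv unfolding separates_def by (metis less_irrefl)
  then show "e \<in> edges (height_graph c G h)" using uv by (simp add: edge_height_graph_iff)
qed

definition reach :: "'a graph \<Rightarrow> ('a \<Rightarrow> nat) \<Rightarrow> 'a \<Rightarrow> nat" where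
  "reach G h v = Max (h ` {w \<in> verts G. w = v \<or> {w, v} \<in> edges G})"

text \<open>Turns the universal part of \<open>separates\<close> into the comparison
  \<open>reach G h v < h u\<close> of two endpoints. The set under \<open>Max\<close> is nonempty
  because it contains \<open>v\<close>.\<close>

lemma reach_less_iff:
  assumes "finite (verts G)" "v \<in> verts G"
  shows "reach G h v < x \<longleftrightarrow> (\<forall>w\<in>verts G. w = v \<or> {w, v} \<in> edges G \<longrightarrow> h w < x)"
  unfolding reach_def using assms by (subst Max_less_iff) auto

lemma height_le_reach:
  assumes "finite (verts G)" "v \<in> verts G"
  shows "h v \<le> reach G h v"
  using reach_less_iff[OF assms, of h "Suc (reach G h v)"] assms(2) by auto

lemma reach_le:
  assumes "finite (verts G)" "v \<in> verts G" "\<And>w. w \<in> verts G \<Longrightarrow> h w \<le> b"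
  shows "reach G h v \<le> b"
  using reach_less_iff[OF assms(1,2), of h "Suc b"] assms(3) by (auto simp: less_Suc_eq_le)

lemma interval_height_graph:
  assumes "simple_graph G"
  shows "interval_graph (height_graph False G h)"
  unfolding interval_graph_def
proof (intro conjI exI ballI impI)
  have fin: "finite (verts G)" using assms by (simp add: simple_graph_def)
  show "simple_graph (height_graph False G h)" by (rule simple_height_graph[OF assms])
  show "real (h v) \<le> real (reach G h v)" if "v \<in> verts (height_graph False G h)" for v
    using height_le_reach[OF fin] that by simp
  show "({u, v} \<in> edges (height_graph False G h)) =
      ({real (h u)..real (reach G h u)} \<inter> {real (h v)..real (reach G h v)} \<noteq> {})"
    if "u \<in> verts (height_graph False G h)" "v \<in> verts (height_graph False G h)" "u \<noteq> v" for u v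
  proof -
    have V: "u \<in> verts G" "v \<in> verts G" using that by simp_all
    have "({real (h u)..real (reach G h u)} \<inter> {real (h v)..real (reach G h v)} \<noteq> {}) \<longleftrightarrow>
        \<not> reach G h v < h u \<and> \<not> reach G h u < h v"
      using height_le_reach[OF fin V(1), of h] height_le_reach[OF fin V(2), of h]
      by (auto simp: not_less)
    then show ?thesis
      using that V by (simp add: edge_height_graph_iff separates_def reach_less_iff[OF fin])
  qed
qed

text \<open>Vertices of height 0 sit in \<open>[0, 1)\<close>, ordered by reach, the others in \<open>(1, 2)\<close>,
  ordered by height; the offset 1/2 makes ties intersect.\<close>

lemma unit_interval_height_graph:
  assumes "simple_graph G"
  shows "unit_interval_graph (height_graph True G h)"
proof -
  have fin: "finite (verts G)" using assms by (simp add: simple_graph_def)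
  define b where "b = Max (insert 0 (h ` verts G))"
  have hb: "h w \<le> b" if "w \<in> verts G" for w
    unfolding b_def using fin that by (intro Max_ge) auto
  have rb: "reach G h v \<le> b" if "v \<in> verts G" for v
    by (rule reach_le[OF fin that hb])
  define x where "x = (\<lambda>v. if h v = 0 then real (reach G h v) else real (h v) + real b + 1/2)"
  define l where "l = (\<lambda>v. x v / (real b + 1))"
  have meet: "{l u..l u + 1} \<inter> {l v..l v + 1} \<noteq> {} \<longleftrightarrow> \<bar>x u - x v\<bar> \<le> real b + 1" for u v
  proof -
    have "{l u..l u + 1} \<inter> {l v..l v + 1} \<noteq> {} \<longleftrightarrow> l u \<le> l v + 1 \<and> l v \<le> l u + 1"
      by auto
    also have "\<dots> \<longleftrightarrow> x u \<le> x v + (real b + 1) \<and> x v \<le> x u + (real b + 1)"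
    proof -
      have "l w \<le> l w' + 1 \<longleftrightarrow> x w \<le> x w' + (real b + 1)" for w w'
      proof -
        have "l w' + 1 = (x w' + (real b + 1)) / (real b + 1)"
          unfolding l_def by (simp add: add_divide_distrib)
        then show ?thesis unfolding l_def by (simp add: divide_le_cancel)
      qed
      then show ?thesis by simp
    qed
    finally show ?thesis by linarith
  qed
  have "{u, v} \<in> edges (height_graph True G h) \<longleftrightarrow> {l u..l u + 1} \<inter> {l v..l v + 1} \<noteq> {}"
    if V: "u \<in> verts G" "v \<in> verts G" "u \<noteq> v" for u v
  proof -
    have sep: "separates True G h u v \<longleftrightarrow> reach G h v < h u \<and> h v = 0"
      "separates True G h v u \<longleftrightarrow> reach G h u < h v \<and> h u = 0"
      using V by (simp_all add: separates_def reach_less_iff[OF fin])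
    have mono: "h u \<le> reach G h u" "h v \<le> reach G h v"
      using height_le_reach[OF fin] V by auto
    have bnd: "h u \<le> b" "h v \<le> b" "reach G h u \<le> b" "reach G h v \<le> b"
      using hb rb V by auto
    \<comment> \<open>Two vertices of height 0, or two of positive height, are at distance at most
      \<open>b\<close> and never separated. In a mixed pair with \<open>h u = 0\<close> the distance
      is \<open>h v + b + 1/2 - reach G h u\<close>, which exceeds \<open>b + 1\<close> exactly when
      \<open>reach G h u < h v\<close>, both being integers.\<close>
    have "\<bar>x u - x v\<bar> \<le> real b + 1 \<longleftrightarrow>
        \<not> separates True G h u v \<and> \<not> separates True G h v u"
    proof (cases "h u = 0"; cases "h v = 0")
      assume "h u = 0" "h v = 0"
      then show ?thesis using bnd unfolding sep x_def by (simp add: abs_le_iff)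
    next
      assume "h u = 0" "h v \<noteq> 0"
      then show ?thesis using bnd unfolding sep x_def
        by (cases "reach G h u < h v") (auto simp: abs_le_iff abs_if)
    next
      assume "h u \<noteq> 0" "h v = 0"
      then show ?thesis using bnd unfolding sep x_def
        by (cases "reach G h v < h u") (auto simp: abs_le_iff abs_if)
    next
      assume "h u \<noteq> 0" "h v \<noteq> 0"
      then show ?thesis using bnd unfolding sep x_def by (simp add: abs_le_iff)
    qed
    then show ?thesis using V unfolding meet by (simp add: edge_height_graph_iff)
  qed
  then show ?thesis
    unfolding unit_interval_graph_def using simple_height_graph[OF assms] by auto
qed

lemma unit_interval_graph_imp_interval_graph:
  assumes "unit_interval_graph G"
  shows "interval_graph G"
proof -
  from assms obtain l :: "'a \<Rightarrow> real" where
    "simple_graph G"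
    "\<forall>u\<in>verts G. \<forall>v\<in>verts G. u \<noteq> v \<longrightarrow>
      ({u, v} \<in> edges G \<longleftrightarrow> {l u..l u + 1} \<inter> {l v..l v + 1} \<noteq> {})"
    unfolding unit_interval_graph_def by blast
  then show ?thesis
    unfolding interval_graph_def
    by (intro conjI exI[of _ l] exI[of _ "\<lambda>v. l v + 1"]) auto
qed

lemma cube_representation_imp_box_representation:
  "cube_representation G B \<Longrightarrow> box_representation G B"
  unfolding cube_representation_def box_representation_def
  using unit_interval_graph_imp_interval_graph by blast

section \<open>Families of height functions that separate all non-edges meeting a block\<close>

text \<open>Only the higher vertex \<open>u\<close> is confined to \<open>W\<close>. A vertex
  outside \<open>W\<close> has height 0 in the families used below and could never be the higher
  one, so it is left to its own block.\<close>

definition covers :: "bool \<Rightarrow> 'a graph \<Rightarrow> 'a set \<Rightarrow> ('a \<Rightarrow> nat) list \<Rightarrow> bool" where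
  "covers c G W hs \<longleftrightarrow> (\<forall>u\<in>W. \<forall>v\<in>verts G. u \<noteq> v \<longrightarrow> {u, v} \<notin> edges G \<longrightarrow>
     (\<exists>h\<in>set hs. separates c G h u v))"

lemma covers_imp_edges_eq:
  assumes "simple_graph G" "covers c G (verts G) hs"
  shows "edges G = all_edges (verts G) \<inter> (\<Inter>I\<in>set (map (height_graph c G) hs). edges I)"
proof (intro equalityI subsetI)
  fix e assume "e \<in> edges G"
  then show "e \<in> all_edges (verts G) \<inter> (\<Inter>I\<in>set (map (height_graph c G) hs). edges I)"
    using edges_subset_height_graph[OF assms(1)] assms(1) by (auto simp: simple_graph_def)
next
  fix e assume e: "e \<in> all_edges (verts G) \<inter> (\<Inter>I\<in>set (map (height_graph c G) hs). edges I)"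
  then obtain u v where uv: "e = {u, v}" "u \<noteq> v" "u \<in> verts G" "v \<in> verts G"
    by (auto simp: card_2_iff all_edges_def)
  show "e \<in> edges G"
  proof (rule ccontr)
    assume "e \<notin> edges G"
    then obtain h where "h \<in> set hs" "separates c G h u v"
      using assms(2) uv unfolding covers_def by blast
    then show False using e uv edge_height_graph_iff[of u G v c h] by auto
  qed
qed

lemma box_representation_height_graphs:
  assumes "simple_graph G" "covers False G (verts G) hs"
  shows "box_representation G (map (height_graph False G) hs)"
  unfolding box_representation_def
  by (rule conjI[OF _ covers_imp_edges_eq[OF assms]])
    (simp add: interval_height_graph[OF assms(1)])

lemma cube_representation_height_graphs:
  assumes "simple_graph G" "covers True G (verts G) hs"
  shows "cube_representation G (map (height_graph True G) hs)"
  unfolding cube_representation_def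
  by (rule conjI[OF _ covers_imp_edges_eq[OF assms]])
    (simp add: unit_interval_height_graph[OF assms(1)])

text \<open>Replaces real endpoints by integers bounded by the size of \<open>A\<close>; ties share
  a rank. As \<open>u\<close> counts itself, every rank in a finite \<open>A\<close> is positive and
  so above the height 0 outside \<open>A\<close>.\<close>

definition rank_height :: "('a \<Rightarrow> real) \<Rightarrow> 'a set \<Rightarrow> 'a \<Rightarrow> nat" where
  "rank_height f A u = (if u \<in> A then card {w \<in> A. f w \<le> f u} else 0)"

text \<open>Ranking preserves strict inequalities of \<open>f\<close> inside \<open>A\<close>, and
  vertices outside \<open>A\<close> drop to 0, which cannot hurt the higher vertex \<open>u\<close>.
  For cubes the same drop puts \<open>v\<close> at height 0, which is why \<open>A\<close> must omit
  \<open>v\<close>.\<close>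

lemma separates_rank_height:
  assumes "finite A" "u \<in> A" "c \<longrightarrow> v \<notin> A"
    and "\<And>w. w \<in> verts G \<Longrightarrow> w = v \<or> {w, v} \<in> edges G \<Longrightarrow> f w < f u"
  shows "separates c G (rank_height f A) u v"
  unfolding separates_def
proof (intro conjI ballI impI)
  fix w assume "w \<in> verts G" "w = v \<or> {w, v} \<in> edges G"
  then have less: "f w < f u" by (rule assms(4))
  show "rank_height f A w < rank_height f A u"
  proof (cases "w \<in> A")
    case True
    have "{x \<in> A. f x \<le> f w} \<subset> {x \<in> A. f x \<le> f u}"
      using less \<open>u \<in> A\<close> by force
    then show ?thesis using True assms(1,2)
      by (simp add: rank_height_def psubset_card_mono)
  next
    case False
    have "0 < card {x \<in> A. f x \<le> f u}" using assms(1,2) by (auto simp: card_gt_0_iff)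
    then show ?thesis using False assms(2) by (simp add: rank_height_def)
  qed
next
  assume c then show "rank_height f A v = 0" using assms(3) by (simp add: rank_height_def)
qed

text \<open>The factor 2 stands for the two sides on which an interval can miss another one. The
  list \<open>F\<close> will be just the block for boxes and the binary digit classes for
  cubes.\<close>

lemma covers_rank_heights:
  assumes G: "simple_graph G" and B: "box_representation G B" and W: "W \<subseteq> verts G"
    and F: "\<And>A. A \<in> set F \<Longrightarrow> A \<subseteq> W"
    and sepF: "\<And>u v. u \<in> W \<Longrightarrow> v \<in> verts G \<Longrightarrow> u \<noteq> v \<Longrightarrow> \<exists>A\<in>set F. u \<in> A \<and> (c \<longrightarrow> v \<notin> A)"
  obtains hs where "length hs \<le> 2 * length B * length F" "covers c G W hs"
    "\<And>h v. h \<in> set hs \<Longrightarrow> h v \<le> card W" "\<And>h v. h \<in> set hs \<Longrightarrow> v \<notin> W \<Longrightarrow> h v = 0"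
proof -
  have fin: "finite (verts G)" using G by (simp add: simple_graph_def)
  have finW: "finite W" using W fin by (rule finite_subset)
  have "\<forall>I. \<exists>l r :: 'a \<Rightarrow> real. I \<in> set B \<longrightarrow> (\<forall>v\<in>verts G. l v \<le> r v) \<and>
        (\<forall>u\<in>verts G. \<forall>v\<in>verts G. u \<noteq> v \<longrightarrow>
           ({u, v} \<in> edges I \<longleftrightarrow> {l u..r u} \<inter> {l v..r v} \<noteq> {}))"
    using B unfolding box_representation_def interval_graph_def by metis
  then obtain l r :: "'a graph \<Rightarrow> 'a \<Rightarrow> real" where
    le: "\<And>I v. I \<in> set B \<Longrightarrow> v \<in> verts G \<Longrightarrow> l I v \<le> r I v" and
    meet: "\<And>I u v. I \<in> set B \<Longrightarrow> u \<in> verts G \<Longrightarrow> v \<in> verts G \<Longrightarrow> u \<noteq> v \<Longrightarrow>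
       {u, v} \<in> edges I \<longleftrightarrow> {l I u..r I u} \<inter> {l I v..r I v} \<noteq> {}"
    by metis
  define hs where "hs = concat (map (\<lambda>I. concat (map (\<lambda>A.
      [rank_height (l I) A, rank_height (\<lambda>v. - r I v) A]) F)) B)"
  have mem: "rank_height (l I) A \<in> set hs" "rank_height (\<lambda>v. - r I v) A \<in> set hs"
    if "I \<in> set B" "A \<in> set F" for I A
    using that unfolding hs_def by auto
  have shape: "\<exists>f A. h = rank_height f A \<and> A \<subseteq> W" if "h \<in> set hs" for h
    using that F unfolding hs_def by auto
  show thesis
  proof
    have len: "length (concat (map (\<lambda>A. [p A, q A]) xs)) = 2 * length xs"
      for p q :: "'a set \<Rightarrow> 'a \<Rightarrow> nat" and xs
      by (induction xs) auto
    have "length hs = 2 * length B * length F"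
      unfolding hs_def by (simp add: length_concat o_def len sum_list_triv)
    then show "length hs \<le> 2 * length B * length F" by simp
    show "h v \<le> card W" if mem_h: "h \<in> set hs" for h v
    proof -
      obtain f A where h: "h = rank_height f A" "A \<subseteq> W" using shape[OF mem_h] by blast
      have "card {w \<in> A. f w \<le> f v} \<le> card W" using h(2) by (intro card_mono finW) auto
      then show ?thesis by (simp add: h(1) rank_height_def)
    qed
    show "h v = 0" if "h \<in> set hs" "v \<notin> W" for h v
      using shape[OF that(1)] that(2) by (auto simp: rank_height_def)
    show "covers c G W hs"
      unfolding covers_def
    proof (intro ballI impI)
      fix u v assume u: "u \<in> W" and v: "v \<in> verts G" and ne: "u \<noteq> v"
        and non: "{u, v} \<notin> edges G"
      have uV: "u \<in> verts G" using u W by blast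
      have "{u, v} \<in> all_edges (verts G)" using uV v ne by (simp add: all_edges_def)
      then obtain I where I: "I \<in> set B" "{u, v} \<notin> edges I"
        using B non unfolding box_representation_def by blast
      obtain A where A: "A \<in> set F" "u \<in> A" "c \<longrightarrow> v \<notin> A" using sepF[OF u v ne] by blast
      have finA: "finite A" using F[OF A(1)] finW by (rule finite_subset)
      \<comment> \<open>An edge of \<open>G\<close> is an edge of \<open>I\<close>, so every
        interval of the closed neighbourhood of \<open>v\<close> meets that of \<open>v\<close>. One
        endpoint of \<open>v\<close> thus bounds all their left endpoints, and the other one all
        their right endpoints.\<close>
      have near: "{l I w..r I w} \<inter> {l I v..r I v} \<noteq> {}" 
        if "w \<in> verts G" "w = v \<or> {w, v} \<in> edges G" for w
      proof (cases "w = v")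
        case True then show ?thesis using le[OF I(1) v] by simp
      next
        case False
        then have "{w, v} \<in> edges I" using that(2) B I(1) unfolding box_representation_def by blast
        then show ?thesis using meet[OF I(1) that(1) v False] by simp
      qed
      have "{l I u..r I u} \<inter> {l I v..r I v} = {}" using meet[OF I(1) uV v ne] I(2) by simp
      \<comment> \<open>If \<open>u\<close> lies to the right of \<open>v\<close>, left endpoints
        serve as heights; if it lies to the left, negated right endpoints do the same on the
        reflected line.\<close>
      then consider "r I v < l I u" | "r I u < l I v"
        using le[OF I(1) uV] le[OF I(1) v] by fastforce
      then show "\<exists>h\<in>set hs. separates c G h u v"
      proof cases
        case 1
        have "separates c G (rank_height (l I) A) u v"
        proof (rule separates_rank_height[OF finA A(2,3)])
          fix w assume "w \<in> verts G" "w = v \<or> {w, v} \<in> edges G"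
          from near[OF this] have "l I w \<le> r I v" by auto
          then show "l I w < l I u" using 1 by simp
        qed
        then show ?thesis using mem[OF I(1) A(1)] by blast
      next
        case 2
        have "separates c G (rank_height (\<lambda>v. - r I v) A) u v"
        proof (rule separates_rank_height[OF finA A(2,3)])
          fix w assume "w \<in> verts G" "w = v \<or> {w, v} \<in> edges G"
          from near[OF this] have "l I v \<le> r I w" by auto
          then show "- r I w < - r I u" using 2 by simp
        qed
        then show ?thesis using mem[OF I(1) A(1)] by blast
      qed
    qed
  qed
qed

text \<open>The indicator of \<open>u\<close> vanishes on the closed neighbourhood of every other
  vertex not adjacent to \<open>u\<close>. One function per vertex of \<open>W\<close> thus works
  for boxes and cubes alike.\<close>

lemma covers_indicators:
  assumes "finite W"
  obtains hs where "length hs = card W" "covers c G W hs"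
    "\<And>h v. h \<in> set hs \<Longrightarrow> h v \<le> 1" "\<And>h v. h \<in> set hs \<Longrightarrow> v \<notin> W \<Longrightarrow> h v = 0"
proof -
  obtain xs where xs: "set xs = W" "distinct xs" using finite_distinct_list[OF assms] by blast
  show thesis
  proof
    let ?hs = "map (\<lambda>u v. of_bool (v = u) :: nat) xs"
    show "length ?hs = card W" using xs distinct_card by fastforce
    show "h v \<le> 1" if "h \<in> set ?hs" for h v using that by auto
    show "h v = 0" if "h \<in> set ?hs" "v \<notin> W" for h v using that xs by auto
    show "covers c G W ?hs"
      unfolding covers_def
    proof (intro ballI impI)
      fix u v assume "u \<in> W" "u \<noteq> v" "{u, v} \<notin> edges G"
      then have "separates c G (\<lambda>v. of_bool (v = u)) u v" unfolding separates_def by auto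
      then show "\<exists>h\<in>set ?hs. separates c G h u v" using xs \<open>u \<in> W\<close> by auto
    qed
  qed
qed

section \<open>Families of height functions as numbers in base \<open>k + 1\<close>\<close>

definition digit :: "nat \<Rightarrow> nat \<Rightarrow> nat \<Rightarrow> nat" where
  "digit b N p = N div b ^ p mod b"

lemma digit_add_mult_power:
  assumes "p < n"
  shows "digit b (N + x * b ^ n) p = digit b N p"
proof (cases "b = 0")
  case False
  have "n = p + Suc (n - Suc p)" using assms by simp
  then have "b ^ n = b ^ p * (b * b ^ (n - Suc p))" by (metis power_add power_Suc)
  then have "x * b ^ n = b ^ p * (b * (x * b ^ (n - Suc p)))" by (simp only: mult_ac)
  then have "(N + x * b ^ n) div b ^ p = b * (x * b ^ (n - Suc p)) + N div b ^ p"
    by (simp only:) (rule div_mult_self2, use False in simp)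
  then show ?thesis by (simp add: digit_def)
next
  case True
  then show ?thesis using assms by (simp add: digit_def power_0_left)
qed

lemma ex_digits:
  assumes "\<And>p. p < n \<Longrightarrow> d p < b"
  shows "\<exists>N<b ^ n. \<forall>p<n. digit b N p = d p"
  using assms
proof (induction n)
  case 0
  then show ?case by simp
next
  case (Suc n)
  then obtain N where N: "N < b ^ n" "\<forall>p<n. digit b N p = d p" by auto
  have dn: "d n < b" using Suc.prems by simp
  then have b: "b > 0" by simp
  show ?case
  proof (intro exI conjI allI impI)
    have "N + d n * b ^ n < (1 + d n) * b ^ n" using N(1) by simp
    also have "\<dots> \<le> b * b ^ n" using dn by (intro mult_right_mono) auto
    finally show "N + d n * b ^ n < b ^ Suc n" by simp
    fix p assume p: "p < Suc n"
    show "digit b (N + d n * b ^ n) p = d p"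
    proof (cases "p = n")
      case True
      then show ?thesis using N(1) dn b by (simp add: digit_def)
    next
      case False
      then show ?thesis using N(2) p by (simp add: digit_add_mult_power)
    qed
  qed
qed

definition block :: "nat graph \<Rightarrow> nat \<Rightarrow> nat \<Rightarrow> nat set" where
  "block G k s = {v \<in> verts G. s \<le> v \<and> v < s + k}"

text \<open>The \<open>k\<close> digits of one vertex are consecutive, one for each of up to
  \<open>k\<close> functions. Shifted by \<open>s * k\<close>, the digit of vertex \<open>v\<close>
  and function \<open>j\<close> has address \<open>v * k + j\<close>, which does not depend on the
  block.\<close>

definition code_height :: "nat \<Rightarrow> nat \<Rightarrow> nat \<Rightarrow> nat \<Rightarrow> nat \<Rightarrow> nat" where
  "code_height k s N j v =
     (if s \<le> v \<and> v < s + k then digit (Suc k) N ((v - s) * k + j) else 0)"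

text \<open>A code \<open>N\<close> describes \<open>N div (k + 1) ^ (k * k)\<close> height functions on a block; putting the
  number of functions into the leading part makes the least code use the fewest functions.\<close>

definition code_heights :: "nat \<Rightarrow> nat \<Rightarrow> nat \<Rightarrow> (nat \<Rightarrow> nat) list" where
  "code_heights k s N = map (code_height k s N) [0..<N div Suc k ^ (k * k)]"

definition best_code :: "bool \<Rightarrow> nat graph \<Rightarrow> nat \<Rightarrow> nat \<Rightarrow> nat" where
  "best_code c G k s = (LEAST N. covers c G (block G k s) (code_heights k s N))"

lemma ex_code:
  assumes cov: "covers c G (block G k s) hs" and len: "length hs \<le> k"
    and le: "\<And>h v. h \<in> set hs \<Longrightarrow> h v \<le> k"
    and supp: "\<And>h v. h \<in> set hs \<Longrightarrow> v \<notin> block G k s \<Longrightarrow> h v = 0"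
  shows "\<exists>N. covers c G (block G k s) (code_heights k s N) \<and>
    N div Suc k ^ (k * k) = length hs"
proof -
  \<comment> \<open>Position \<open>p\<close> belongs to vertex \<open>s + p div k\<close> and
    function \<open>p mod k\<close>; columns from \<open>length hs\<close> onwards are filled with
    0.\<close>
  let ?d = "\<lambda>p. if p mod k < length hs then (hs ! (p mod k)) (s + p div k) else 0"
  have "?d p < Suc k" for p using le by (auto simp: less_Suc_eq_le)
  then obtain M where M: "M < Suc k ^ (k * k)" "\<forall>p<k*k. digit (Suc k) M p = ?d p"
    using ex_digits[of "k * k" ?d "Suc k"] by blast
  define N where "N = M + length hs * Suc k ^ (k * k)"
  have div: "N div Suc k ^ (k * k) = length hs" using M(1) by (simp add: N_def)
  have dig: "digit (Suc k) N p = ?d p" if "p < k * k" for p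
    using M(2) that by (simp add: N_def digit_add_mult_power)
  \<comment> \<open>Agreement on \<open>verts G\<close> is enough, since \<open>separates\<close>
    evaluates heights at vertices of \<open>G\<close> only.\<close>
  have eq: "code_height k s N j v = (hs ! j) v" if "j < length hs" "v \<in> verts G" for j v
  proof (cases "v \<in> block G k s")
    case True
    have "j < k" using that len by simp
    have "(v - s) * k + j < k * k"
    proof -
      have "(v - s) * k + j < (v - s + 1) * k" using \<open>j < k\<close> by simp
      also have "\<dots> \<le> k * k" using True by (intro mult_right_mono) (auto simp: block_def)
      finally show ?thesis .
    qed
    from dig[OF this] show ?thesis
      using True \<open>j < k\<close> that by (simp add: code_height_def block_def)
  next
    case False
    then show ?thesis using that supp by (auto simp: code_height_def block_def)
  qed
  have "covers c G (block G k s) (code_heights k s N)"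
    unfolding covers_def
  proof (intro ballI impI)
    fix u v assume uv: "u \<in> block G k s" "v \<in> verts G" "u \<noteq> v" "{u, v} \<notin> edges G"
    then obtain h where "h \<in> set hs" "separates c G h u v" using cov unfolding covers_def by blast
    then obtain j where j: "j < length hs" "separates c G (hs ! j) u v"
      by (metis in_set_conv_nth)
    have "u \<in> verts G" using uv(1) by (simp add: block_def)
    then have "separates c G (code_height k s N j) u v"
      using j uv(2) unfolding separates_def by (simp add: eq)
    then show "\<exists>h\<in>set (code_heights k s N). separates c G h u v"
      using j(1) by (auto simp: code_heights_def div)
  qed
  with div show ?thesis by blast
qed

lemma card_block_le: "card (block G k s) \<le> k"
proof -
  have "card (block G k s) \<le> card {s..<s + k}" by (rule card_mono) (auto simp: block_def)
  then show ?thesis by simp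
qed

lemma finite_block: "finite (block G k s)"
  by (rule finite_subset[of _ "{s..<s + k}"]) (auto simp: block_def)

text \<open>The indicators of the block yield a code with at most \<open>k\<close> functions, so a
  least code exists. Its count is no larger, because the count is the leading part, and so the
  \<open>k\<close> digits per vertex suffice to describe it.\<close>

lemma best_code:
  assumes "0 < k"
  shows covers_best_code: "covers c G (block G k s) (code_heights k s (best_code c G k s))"
    and best_code_count: "best_code c G k s div Suc k ^ (k * k) \<le> k"
proof -
  obtain hs where hs: "length hs = card (block G k s)" "covers c G (block G k s) hs"
    "\<And>h v. h \<in> set hs \<Longrightarrow> h v \<le> 1" "\<And>h v. h \<in> set hs \<Longrightarrow> v \<notin> block G k s \<Longrightarrow> h v = 0"
    by (rule covers_indicators[OF finite_block]) auto
  have "h v \<le> k" if "h \<in> set hs" for h v using hs(3)[OF that, of v] assms by simp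
  then obtain N where N: "covers c G (block G k s) (code_heights k s N)"
    "N div Suc k ^ (k * k) = length hs"
    using ex_code[OF hs(2)] hs(4) card_block_le[of G k s] hs(1) by auto
  from N(1) show "covers c G (block G k s) (code_heights k s (best_code c G k s))"
    unfolding best_code_def by (rule LeastI)
  have "best_code c G k s \<le> N" unfolding best_code_def by (rule Least_le) (rule N(1))
  from div_le_mono[OF this, of "Suc k ^ (k * k)"]
  have "best_code c G k s div Suc k ^ (k * k) \<le> length hs" by (simp only: N(2))
  then show "best_code c G k s div Suc k ^ (k * k) \<le> k"
    using card_block_le[of G k s] hs(1) by simp
qed

text \<open>A family of ranks can be coded only if it has at most \<open>k\<close> members. If the
  bound exceeds \<open>k\<close>, the indicators already do better.\<close>

lemma best_code_count_le:
  assumes "0 < k" "simple_graph G" "box_representation G B"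
    and F: "\<And>A. A \<in> set F \<Longrightarrow> A \<subseteq> block G k s"
    and sepF: "\<And>u v. u \<in> block G k s \<Longrightarrow> v \<in> verts G \<Longrightarrow> u \<noteq> v \<Longrightarrow>
      \<exists>A\<in>set F. u \<in> A \<and> (c \<longrightarrow> v \<notin> A)"
  shows "best_code c G k s div Suc k ^ (k * k) \<le> 2 * length B * length F"
proof (cases "2 * length B * length F \<le> k")
  case True
  have W: "block G k s \<subseteq> verts G" by (auto simp: block_def)
  obtain hs where hs: "length hs \<le> 2 * length B * length F" "covers c G (block G k s) hs"
    "\<And>h v. h \<in> set hs \<Longrightarrow> h v \<le> card (block G k s)"
    "\<And>h v. h \<in> set hs \<Longrightarrow> v \<notin> block G k s \<Longrightarrow> h v = 0"
    by (rule covers_rank_heights[OF assms(2,3) W F sepF]) auto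
  have "h v \<le> k" if "h \<in> set hs" for h v
    using hs(3)[OF that, of v] card_block_le[of G k s] by simp
  then obtain N where N: "covers c G (block G k s) (code_heights k s N)"
    "N div Suc k ^ (k * k) = length hs"
    using ex_code[OF hs(2)] hs(4) True hs(1) by auto
  have "best_code c G k s \<le> N" unfolding best_code_def by (rule Least_le) (rule N(1))
  from div_le_mono[OF this, of "Suc k ^ (k * k)"]
  have "best_code c G k s div Suc k ^ (k * k) \<le> length hs" by (simp only: N(2))
  then show ?thesis using hs(1) by (rule le_trans)
next
  case False
  then show ?thesis using best_code_count[OF assms(1), of c G s] by simp
qed

section \<open>Splitting a block by binary digits\<close>

text \<open>Both values of each digit are listed because the class has to contain \<open>u\<close>,
  whichever of the two vertices has the bit set. Digits are those of the offset in the block, so few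
  of them suffice.\<close>

definition bit_classes :: "nat graph \<Rightarrow> nat \<Rightarrow> nat \<Rightarrow> nat \<Rightarrow> nat set list" where
  "bit_classes G k s m = concat (map (\<lambda>i.
     [{v \<in> block G k s. bit (v - s) i}, {v \<in> block G k s. \<not> bit (v - s) i}]) [0..<m])"

lemma length_bit_classes: "length (bit_classes G k s m) = 2 * m"
  by (induction m) (auto simp: bit_classes_def)

text \<open>Distinct offsets below \<open>2 ^ m\<close> differ in one of their \<open>m\<close>
  lowest bits. If \<open>v\<close> is outside the block, any class containing \<open>u\<close> will
  do, and \<open>0 < m\<close> provides one.\<close>

lemma bit_classes_separate:
  assumes "k \<le> 2 ^ m" "0 < m" "u \<in> block G k s" "v \<in> verts G" "u \<noteq> v"
  shows "\<exists>A\<in>set (bit_classes G k s m). u \<in> A \<and> v \<notin> A"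
proof -
  have in_class: "{w \<in> block G k s. bit (w - s) i = bit (u - s) i} \<in> set (bit_classes G k s m)"
    if "i < m" for i
    using that unfolding bit_classes_def by (cases "bit (u - s) i") auto
  have "\<exists>i<m. v \<in> block G k s \<longrightarrow> bit (v - s) i \<noteq> bit (u - s) i"
  proof (cases "v \<in> block G k s")
    case True
    then have uv: "u - s < 2 ^ m" "v - s < 2 ^ m" "u - s \<noteq> v - s"
      using assms by (auto simp: block_def)
    then have "take_bit m (u - s) \<noteq> take_bit m (v - s)" by (simp add: take_bit_nat_eq_self)
    then show ?thesis by (auto simp: bit_eq_iff bit_take_bit_iff)
  next
    case False
    then show ?thesis using assms(2) by blast
  qed
  then obtain i where "i < m" "v \<in> block G k s \<longrightarrow> bit (v - s) i \<noteq> bit (u - s) i" by blast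
  with assms(3) show ?thesis by (intro bexI[OF _ in_class[of i]]) auto
qed

section \<open>Block size and the assembled representation\<close>

text \<open>The largest admissible block size up to \<open>i\<close>, with default 1 so that blocks
  are never empty. The recursion tests the candidates one at a time, in the same way as the loop of
  \<open>BlockSize\<close>.\<close>

primrec size_below :: "nat \<Rightarrow> nat \<Rightarrow> nat" where
  "size_below n 0 = 1"
| "size_below n (Suc i) = (if Suc (Suc i) ^ (Suc i * Suc i) \<le> n then Suc i else size_below n i)"

definition block_size :: "nat \<Rightarrow> nat" where
  "block_size n = size_below n n"

definition block_count :: "nat \<Rightarrow> nat" where
  "block_count n = (n + block_size n - 1) div block_size n"

lemma size_below_pos: "0 < size_below n i"
proof (induction i)
  case (Suc i)
  then show ?case by (simp only: size_below.simps) simp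
qed simp

lemma block_size_pos: "0 < block_size n"
  by (simp add: block_size_def size_below_pos)

definition all_heights :: "bool \<Rightarrow> nat graph \<Rightarrow> (nat \<Rightarrow> nat) list" where
  "all_heights c G = (let n = card (verts G); k = block_size n in
     concat (map (\<lambda>i. code_heights k (i * k) (best_code c G k (i * k))) [0..<block_count n]))"

text \<open>A function of \<open>G\<close> alone, so that the approximation factor can be settled
  without any program and the program is only required to compute this very list.\<close>

definition representation :: "bool \<Rightarrow> nat graph \<Rightarrow> nat graph list" where
  "representation c G = map (height_graph c G) (all_heights c G)"

lemma labelled_graph_verts:
  assumes "G \<in> labelled_graphs"
  shows "simple_graph G" "verts G = {..<card (verts G)}"
proof -
  from assms obtain n where "simple_graph G" and V: "verts G = {..<n}"
    unfolding labelled_graphs_def by blast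
  then show "simple_graph G" by blast
  show "verts G = {..<card (verts G)}" unfolding V by simp
qed

lemma covers_all_heights:
  assumes "G \<in> labelled_graphs"
  shows "covers c G (verts G) (all_heights c G)"
  unfolding covers_def
proof (intro ballI impI)
  define n where "n = card (verts G)"
  define k where "k = block_size n"
  have k: "0 < k" by (simp add: k_def block_size_pos)
  fix u v assume uv: "u \<in> verts G" "v \<in> verts G" "u \<noteq> v" "{u, v} \<notin> edges G"
  define i where "i = u div k"
  have "u < n" using uv(1) labelled_graph_verts(2)[OF assms] unfolding n_def by blast
  have "u \<in> block G k (i * k)"
    using k uv(1) unfolding block_def i_def
    by (simp add: div_mult2_eq dividend_less_div_times add.commute)
  then obtain h where h: "h \<in> set (code_heights k (i * k) (best_code c G k (i * k)))"
      "separates c G h u v"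
    using covers_best_code[OF k, of c G "i * k"] uv unfolding covers_def by blast
  have "i < block_count n"
  proof -
    have "i \<le> (n - 1) div k" unfolding i_def using \<open>u < n\<close> by (intro div_le_mono) simp
    also have "\<dots> < (n - 1) div k + 1" by simp
    also have "\<dots> = (n - 1 + k) div k" using k by simp
    also have "n - 1 + k = n + k - 1" using \<open>u < n\<close> by simp
    finally show ?thesis by (simp add: block_count_def k_def)
  qed
  then show "\<exists>h\<in>set (all_heights c G). separates c G h u v"
    using h unfolding all_heights_def Let_def n_def[symmetric] k_def[symmetric] by auto
qed

section \<open>Comparison with boxicity and cubicity\<close>

lemma length_representation_le:
  assumes "\<And>s. best_code c G (block_size (card (verts G))) s div
      Suc (block_size (card (verts G))) ^ (block_size (card (verts G)) * block_size (card (verts G))) \<le> b"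
  shows "length (representation c G) \<le> block_count (card (verts G)) * b"
proof -
  have "length (concat (map f [0..<m])) \<le> m * b" if "\<And>i. length (f i) \<le> b"
    for f :: "nat \<Rightarrow> (nat \<Rightarrow> nat) list" and m
  proof (induction m)
    case (Suc m)
    then show ?case using that[of m] by simp
  qed simp
  then show ?thesis using assms
    unfolding representation_def all_heights_def Let_def by (simp add: code_heights_def)
qed

lemma length_box_representation_le:
  assumes "G \<in> labelled_graphs" "box_representation G B"
  shows "length (representation False G) \<le> block_count (card (verts G)) * (2 * length B)"
proof (rule length_representation_le)
  fix s
  show "best_code False G (block_size (card (verts G))) s div
      Suc (block_size (card (verts G))) ^ (block_size (card (verts G)) * block_size (card (verts G)))
      \<le> 2 * length B"
    using best_code_count_le[OF block_size_pos labelled_graph_verts(1)[OF assms(1)] assms(2),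
        of "[block G (block_size (card (verts G))) s]"] by simp
qed

text \<open>The added 1 keeps the value positive at \<open>k = 1\<close>, where one class is still
  required to separate the single vertex of a block from the vertices outside.\<close>

definition bit_length :: "nat \<Rightarrow> nat" where
  "bit_length k = nat \<lceil>log 2 (real k)\<rceil> + 1"

lemma le_two_power_bit_length: "k \<le> 2 ^ bit_length k"
proof (cases "k = 0")
  case False
  have "real k = 2 powr log 2 (real k)" using False by simp
  also have "\<dots> \<le> 2 powr real (bit_length k)"
    unfolding bit_length_def by (intro powr_mono) linarith+
  finally have "real k \<le> real (2 ^ bit_length k)" by (simp add: powr_realpow)
  then show ?thesis by linarith
qed simp

text \<open>A cube representation is a box representation, so the ranking argument applies to it.
  The 4 is two endpoints times two values of each binary digit.\<close>

lemma length_cube_representation_le: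
  assumes "G \<in> labelled_graphs" "cube_representation G C"
  shows "length (representation True G) \<le>
    block_count (card (verts G)) * (4 * bit_length (block_size (card (verts G))) * length C)"
proof (rule length_representation_le)
  fix s
  let ?k = "block_size (card (verts G))"
  show "best_code True G ?k s div Suc ?k ^ (?k * ?k) \<le> 4 * bit_length ?k * length C"
  proof -
    have "best_code True G ?k s div Suc ?k ^ (?k * ?k)
        \<le> 2 * length C * length (bit_classes G ?k s (bit_length ?k))"
    proof (rule best_code_count_le[OF block_size_pos labelled_graph_verts(1)[OF assms(1)]
          cube_representation_imp_box_representation[OF assms(2)]])
      show "A \<subseteq> block G ?k s" if "A \<in> set (bit_classes G ?k s (bit_length ?k))" for A
        using that by (auto simp: bit_classes_def)
      show "\<exists>A\<in>set (bit_classes G ?k s (bit_length ?k)). u \<in> A \<and> (True \<longrightarrow> v \<notin> A)"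
        if "u \<in> block G ?k s" "v \<in> verts G" "u \<noteq> v" for u v
        using bit_classes_separate[OF le_two_power_bit_length _ that] by (simp add: bit_length_def)
    qed
    then show ?thesis by (simp add: length_bit_classes mult_ac)
  qed
qed

lemma box_representation_representation:
  assumes "G \<in> labelled_graphs"
  shows "box_representation G (representation False G)"
  unfolding representation_def
  by (rule box_representation_height_graphs[OF labelled_graph_verts(1)[OF assms]
        covers_all_heights[OF assms]])

lemma cube_representation_representation:
  assumes "G \<in> labelled_graphs"
  shows "cube_representation G (representation True G)"
  unfolding representation_def
  by (rule cube_representation_height_graphs[OF labelled_graph_verts(1)[OF assms]
        covers_all_heights[OF assms]])

text \<open>The minimum in \<open>boxicity\<close> is attained because the computed list is itself a
  representation. For complete graphs the empty list represents \<open>G\<close>, which agrees with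
  boxicity 0.\<close>

lemma length_representation_boxicity:
  assumes "G \<in> labelled_graphs"
  shows "length (representation False G) \<le> block_count (card (verts G)) * (2 * boxicity G)"
proof (cases "complete_graph G")
  case True
  then have "box_representation G []" by (simp add: box_representation_def complete_graph_def)
  from length_box_representation_le[OF assms this] show ?thesis by simp
next
  case False
  have "\<exists>B. box_representation G B \<and> length B = boxicity G"
    unfolding boxicity_def if_not_P[OF False]
    by (rule LeastI_ex) (use box_representation_representation[OF assms] in blast)
  then obtain B where "box_representation G B" "length B = boxicity G" by blast
  then show ?thesis using length_box_representation_le[OF assms, of B] by simp
qed

lemma length_representation_cubicity:
  assumes "G \<in> labelled_graphs"
  shows "length (representation True G) \<le>
    block_count (card (verts G)) * (4 * bit_length (block_size (card (verts G))) * cubicity G)"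
proof (cases "complete_graph G")
  case True
  then have "cube_representation G []" by (simp add: cube_representation_def complete_graph_def)
  from length_cube_representation_le[OF assms this] show ?thesis by simp
next
  case False
  have "\<exists>C. cube_representation G C \<and> length C = cubicity G"
    unfolding cubicity_def if_not_P[OF False]
    by (rule LeastI_ex) (use cube_representation_representation[OF assms] in blast)
  then obtain C where "cube_representation G C" "length C = cubicity G" by blast
  then show ?thesis using length_cube_representation_le[OF assms, of C] by simp
qed

section \<open>Reasoning about programs\<close>

text \<open>Total correctness with a time budget. As \<open>T\<close> is only an upper bound, exact
  step counts never have to be computed.\<close>

definition runs :: "prog \<Rightarrow> memory \<Rightarrow> nat \<Rightarrow> (memory \<Rightarrow> bool) \<Rightarrow> bool" where
  "runs c m T Q \<longleftrightarrow> (\<exists>t m'. exec c m t m' \<and> t \<le> T \<and> Q m')"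

lemma runs_weaken:
  assumes "runs c m T Q" "T \<le> T'" "\<And>m'. Q m' \<Longrightarrow> Q' m'"
  shows "runs c m T' Q'"
  using assms unfolding runs_def by (meson le_trans)

lemma exec_Skip_iff: "exec Skip m t m' \<longleftrightarrow> t = 1 \<and> m' = m"
  using exec.Skip[of m] by (auto elim: exec_SkipE)

lemma exec_Assign_iff:
  "exec (Assign a i e) m t m' \<longleftrightarrow>
     t = 1 \<and> m' = m(a := (m a)(eval_expr i m := eval_expr e m))"
  using exec.Assign[of a i e m] by (auto elim: exec_AssignE)

lemma exec_Seq_iff:
  "exec (Seq c1 c2) m t m' \<longleftrightarrow>
     (\<exists>t1 m1 t2. t = t1 + t2 \<and> exec c1 m t1 m1 \<and> exec c2 m1 t2 m')"
  by (blast elim: exec_SeqE intro: exec.Seq)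

lemma exec_If_iff:
  "exec (If b c1 c2) m t m' \<longleftrightarrow>
     (\<exists>t'. t = t' + 1 \<and> exec (if eval_expr b m \<noteq> 0 then c1 else c2) m t' m')"
proof
  assume "exec (If b c1 c2) m t m'"
  then show "\<exists>t'. t = t' + 1 \<and> exec (if eval_expr b m \<noteq> 0 then c1 else c2) m t' m'"
    by (rule exec_IfE) auto
next
  assume "\<exists>t'. t = t' + 1 \<and> exec (if eval_expr b m \<noteq> 0 then c1 else c2) m t' m'"
  then show "exec (If b c1 c2) m t m'"
    by (cases "eval_expr b m = 0") (auto intro: exec.IfTrue[simplified] exec.IfFalse[simplified])
qed

lemma runs_Skip [simp]: "runs Skip m T Q \<longleftrightarrow> 1 \<le> T \<and> Q m"
  by (simp add: runs_def exec_Skip_iff)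

lemma runs_Assign [simp]:
  "runs (Assign a i e) m T Q \<longleftrightarrow>
     1 \<le> T \<and> Q (m(a := (m a)(eval_expr i m := eval_expr e m)))"
  by (simp add: runs_def exec_Assign_iff)

lemma runs_If [simp]:
  "runs (If b c1 c2) m T Q \<longleftrightarrow>
     1 \<le> T \<and> (if eval_expr b m \<noteq> 0 then runs c1 m (T - 1) Q else runs c2 m (T - 1) Q)"
proof -
  have "(\<exists>t m'. (\<exists>t'. t = t' + 1 \<and> exec c m t' m') \<and> t \<le> T \<and> Q m') \<longleftrightarrow>
      1 \<le> T \<and> (\<exists>t m'. exec c m t m' \<and> t \<le> T - 1 \<and> Q m')" for c
    by (cases T) auto
  then show ?thesis unfolding runs_def exec_If_iff by auto
qed

lemma runs_Seq_iff:
  "runs (Seq c1 c2) m T Q \<longleftrightarrow> (\<exists>t1 m1. exec c1 m t1 m1 \<and> t1 \<le> T \<and> runs c2 m1 (T - t1) Q)"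
proof
  assume "runs (Seq c1 c2) m T Q"
  then obtain t1 m1 t2 m' where "exec c1 m t1 m1" "exec c2 m1 t2 m'" "t1 + t2 \<le> T" "Q m'"
    unfolding runs_def exec_Seq_iff by blast
  moreover from this have "t1 \<le> T" "t2 \<le> T - t1" by auto
  ultimately show "\<exists>t1 m1. exec c1 m t1 m1 \<and> t1 \<le> T \<and> runs c2 m1 (T - t1) Q"
    unfolding runs_def by blast
next
  assume "\<exists>t1 m1. exec c1 m t1 m1 \<and> t1 \<le> T \<and> runs c2 m1 (T - t1) Q"
  then obtain t1 m1 t2 m' where "exec c1 m t1 m1" "exec c2 m1 t2 m'" "t1 \<le> T" "t2 \<le> T - t1" "Q m'"
    unfolding runs_def by blast
  moreover from this have "t1 + t2 \<le> T" by auto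
  ultimately show "runs (Seq c1 c2) m T Q"
    unfolding runs_def exec_Seq_iff by blast
qed

lemma runs_Seq:
  assumes "runs c1 m T1 P" "T1 \<le> T" "\<And>m1. P m1 \<Longrightarrow> runs c2 m1 (T - T1) Q"
  shows "runs (Seq c1 c2) m T Q"
proof -
  obtain t1 m1 where 1: "exec c1 m t1 m1" "t1 \<le> T1" "P m1"
    using assms(1) unfolding runs_def by blast
  have "runs c2 m1 (T - t1) Q"
    by (rule runs_weaken[OF assms(3)[OF 1(3)]]) (use 1(2) in auto)
  then show ?thesis unfolding runs_Seq_iff using 1 assms(2) le_trans by blast
qed

lemma runs_Seq_Assign [simp]:
  "runs (Seq (Assign a i e) c) m T Q \<longleftrightarrow>
     1 \<le> T \<and> runs c (m(a := (m a)(eval_expr i m := eval_expr e m))) (T - 1) Q"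
  by (simp add: runs_Seq_iff exec_Assign_iff)

text \<open>The invariant is indexed by the number of completed passes, and \<open>M\<close> is
  known in advance, so no separate termination measure occurs. Each pass pays 1 for its test; the
  final 1 is the failing test.\<close>

lemma runs_While:
  assumes "I 0 m"
    and "\<And>i m. i < M \<Longrightarrow> I i m \<Longrightarrow> eval_expr b m \<noteq> 0"
    and "\<And>i m. i < M \<Longrightarrow> I i m \<Longrightarrow> runs c m T (I (Suc i))"
    and "\<And>m. I M m \<Longrightarrow> eval_expr b m = 0"
  shows "runs (While b c) m (M * (T + 1) + 1) (I M)"
proof -
  have "runs (While b c) m ((M - i) * (T + 1) + 1) (I M)" if "i \<le> M" "I i m" for i m
    using that
  proof (induction "M - i" arbitrary: i m)
    case 0
    then have "i = M" by simp
    then have "exec (While b c) m 1 m" using 0 assms(4) by (intro WhileFalse) auto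
    then show ?case using 0 \<open>i = M\<close> unfolding runs_def by (intro exI[of _ 1] exI[of _ m]) auto
  next
    case (Suc d)
    then have i: "i < M" by simp
    obtain t1 m1 where 1: "exec c m t1 m1" "t1 \<le> T" "I (Suc i) m1"
      using assms(3)[OF i Suc.prems(2)] unfolding runs_def by blast
    have "runs (While b c) m1 ((M - Suc i) * (T + 1) + 1) (I M)"
      by (rule Suc.hyps(1)) (use Suc.hyps(2) i 1 in auto)
    then obtain t2 m2 where 2: "exec (While b c) m1 t2 m2" "t2 \<le> (M - Suc i) * (T + 1) + 1" "I M m2"
      unfolding runs_def by blast
    have "exec (While b c) m (t1 + t2 + 1) m2"
      by (rule WhileTrue[OF assms(2)[OF i Suc.prems(2)] 1(1) 2(1)])
    moreover have "M - i = Suc (M - Suc i)" using i by simp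
    then have "t1 + t2 + 1 \<le> (M - i) * (T + 1) + 1" using 1(2) 2(2) by simp
    ultimately show ?case using 2(3) unfolding runs_def by blast
  qed
  from this[of 0 m] assms(1) show ?thesis by simp
qed

section \<open>Derived tests, counted loops and frames\<close>

abbreviation Var :: "nat \<Rightarrow> expr" where "Var x \<equiv> Cell x (Const 0)"
abbreviation Set :: "nat \<Rightarrow> expr \<Rightarrow> prog" where "Set x e \<equiv> Assign x (Const 0) e"
abbreviation Inc :: "nat \<Rightarrow> prog" where "Inc x \<equiv> Set x (Plus (Var x) (Const 1))"

text \<open>Truncated subtraction makes \<open>Minus (Const 1) a\<close> equal to 1 if
  \<open>a\<close> is 0 and to 0 otherwise; all other tests are built from it and have value 0 or
  1.\<close>

definition Not :: "expr \<Rightarrow> expr" where "Not a = Minus (Const 1) a"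
definition And :: "expr \<Rightarrow> expr \<Rightarrow> expr" where "And a b = Not (Plus (Not a) (Not b))"
definition Or :: "expr \<Rightarrow> expr \<Rightarrow> expr" where "Or a b = Not (Not (Plus a b))"
definition Le :: "expr \<Rightarrow> expr \<Rightarrow> expr" where "Le a b = Not (Minus a b)"
definition Less :: "expr \<Rightarrow> expr \<Rightarrow> expr" where "Less a b = Not (Le b a)"
definition Eq :: "expr \<Rightarrow> expr \<Rightarrow> expr" where "Eq a b = And (Le a b) (Le b a)"

lemma eval_tests [simp]:
  "eval_expr (Not a) m = of_bool (eval_expr a m = 0)"
  "eval_expr (And a b) m = of_bool (eval_expr a m \<noteq> 0 \<and> eval_expr b m \<noteq> 0)"
  "eval_expr (Or a b) m = of_bool (eval_expr a m \<noteq> 0 \<or> eval_expr b m \<noteq> 0)"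
  "eval_expr (Le a b) m = of_bool (eval_expr a m \<le> eval_expr b m)"
  "eval_expr (Less a b) m = of_bool (eval_expr a m < eval_expr b m)"
  "eval_expr (Eq a b) m = of_bool (eval_expr a m = eval_expr b m)"
  by (auto simp: Not_def And_def Or_def Le_def Less_def Eq_def)

definition For :: "nat \<Rightarrow> expr \<Rightarrow> prog \<Rightarrow> prog" where
  "For x e c = Seq (Set x (Const 0)) (While (Less (Var x) e) (Seq c (Inc x)))"

text \<open>The 2 per pass pays for the increment and the test, the final 2 for the initial
  assignment and the failing test. The invariant may speak about the counter's bank, so it is
  demanded for the memory after the increment.\<close>

lemma runs_For:
  assumes "I 0 (m(x := (m x)(0 := 0)))"
    and "\<And>i m. i \<le> M \<Longrightarrow> I i m \<Longrightarrow> m x 0 = i \<Longrightarrow> eval_expr e m = M"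
    and "\<And>i m. i < M \<Longrightarrow> I i m \<Longrightarrow> m x 0 = i \<Longrightarrow>
      runs c m T (\<lambda>m'. m' x 0 = i \<and> I (Suc i) (m'(x := (m' x)(0 := Suc i))))"
  shows "runs (For x e c) m (M * (T + 2) + 2) (I M)"
proof -
  have "runs (While (Less (Var x) e) (Seq c (Inc x))) (m(x := (m x)(0 := 0)))
      (M * ((T + 1) + 1) + 1) (\<lambda>m. I M m \<and> m x 0 = M)"
  proof (rule runs_While[where I = "\<lambda>i m. I i m \<and> m x 0 = i"])
    fix i m assume i: "i < M" "I i m \<and> m x 0 = i"
    show "runs (Seq c (Inc x)) m (T + 1) (\<lambda>m. I (Suc i) m \<and> m x 0 = Suc i)"
      by (rule runs_Seq[OF assms(3)[OF i(1), of m]]) (use i in auto)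
  next
    fix i m assume "i < M" "I i m \<and> m x 0 = i"
    then show "eval_expr (Less (Var x) e) m \<noteq> 0" using assms(2)[of i m] by simp
  next
    fix m assume "I M m \<and> m x 0 = M"
    then show "eval_expr (Less (Var x) e) m = 0" using assms(2)[of M m] by simp
  qed (use assms(1) in simp)
  then have "runs (While (Less (Var x) e) (Seq c (Inc x))) (m(x := (m x)(0 := 0)))
      (M * (T + 2) + 2 - 1) (I M)"
    by (rule runs_weaken) auto
  then show ?thesis by (simp add: For_def)
qed

text \<open>Whole banks are tracked because a bank holds either a single scalar, in cell 0, or one
  array.\<close>

definition frame :: "nat set \<Rightarrow> memory \<Rightarrow> memory \<Rightarrow> bool" where
  "frame S m m' \<longleftrightarrow> (\<forall>a. a \<notin> S \<longrightarrow> m' a = m a)"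

lemma frameD: "frame S m m' \<Longrightarrow> a \<notin> S \<Longrightarrow> m' a = m a"
  by (simp add: frame_def)

lemma frame_refl: "frame S m m"
  by (simp add: frame_def)

lemma frame_trans: "frame S m m1 \<Longrightarrow> frame S' m1 m2 \<Longrightarrow> S' \<subseteq> S \<Longrightarrow> frame S m m2"
  by (auto simp: frame_def)

lemma frame_update: "frame S m m1 \<Longrightarrow> a \<in> S \<Longrightarrow> frame S m (m1(a := f))"
  by (auto simp: frame_def)

section \<open>The program\<close>

text \<open>Memory layout. 0: input, later output; 1: length; 2: \<open>n\<close>; 3: block size \<open>k\<close>;
  4: starts of the rows of the adjacency matrix; 5: multiples of \<open>k\<close>; 6: digits of the code,
  those of vertex \<open>v\<close> starting at cell \<open>v * k\<close>; 7: number of coded height functions;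
  8: first vertex of the block; 10: \<open>k * k\<close>; 11, 12: vertices; 13: number of a height function;
  14: vertex; 15, 16, 17, 18: truth values; 19: position of a digit; 20: graphs written so far;
  21: their total length; 22: their number; 23: temporary.\<close>

definition Height :: "nat \<Rightarrow> expr" where
  "Height x = Cell 6 (Plus (Cell 5 (Var x)) (Var 13))"

text \<open>The start of each row is looked up in bank 4, as the machine cannot multiply; bank 5
  serves the same purpose in \<open>Height\<close>.\<close>

definition Adj :: "nat \<Rightarrow> nat \<Rightarrow> expr" where
  "Adj x y = Cell 0 (Plus (Cell 4 (Var x)) (Var y))"

text \<open>The choice on \<open>c\<close> is made when the program is built, so there is one
  program for boxes and another one for cubes.\<close>

definition Separates :: "bool \<Rightarrow> nat \<Rightarrow> nat \<Rightarrow> nat \<Rightarrow> prog" where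
  "Separates c x y r = Seq (Set r (Const 1)) (Seq
     (For 14 (Var 2)
       (If (And (Or (Eq (Var 14) (Var y)) (Adj 14 y)) (Le (Height x) (Height 14)))
         (Set r (Const 0)) Skip))
     (If (if c then Height y else Const 0) (Set r (Const 0)) Skip))"

text \<open>Cell 18 becomes 1 when an uncovered pair is found, and so is directly the loop test of
  \<open>Search\<close>. There is no early exit: every loop has a known number of passes, as
  \<open>runs_For\<close> requires.\<close>

definition Check :: "bool \<Rightarrow> prog" where
  "Check c = Seq (Set 18 (Const 0))
     (For 11 (Var 2) (If (And (Le (Var 8) (Var 11)) (Less (Var 11) (Plus (Var 8) (Var 3))))
       (For 12 (Var 2) (If (Or (Eq (Var 11) (Var 12)) (Adj 11 12)) Skip
         (Seq (Set 17 (Const 0)) (Seq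
           (For 13 (Var 7) (Seq (Separates c 11 12 15) (If (Var 15) (Set 17 (Const 1)) Skip)))
           (If (Var 17) Skip (Set 18 (Const 1)))))))
       Skip))"

text \<open>Adds 1 in base \<open>k + 1\<close>: maximal digits are reset and the carry moves on.
  The carry loop carries no bound of its own; the cell just behind the \<open>k * k\<close> digits
  holds 0, which is less than \<open>k\<close>. A carry that gets there raises the number of
  functions.\<close>

definition Increment :: prog where
  "Increment = Seq (Set 19 (Cell 5 (Var 8)))
     (Seq (While (Le (Var 3) (Cell 6 (Var 19))) (Seq (Assign 6 (Var 19) (Const 0)) (Inc 19)))
       (If (Less (Var 19) (Plus (Cell 5 (Var 8)) (Var 10)))
         (Assign 6 (Var 19) (Plus (Cell 6 (Var 19)) (Const 1))) (Inc 7)))"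

definition Search :: "bool \<Rightarrow> prog" where
  "Search c = Seq (Check c) (While (Var 18) (Seq Increment (Check c)))"

text \<open>The graphs are collected in bank 20 because bank 0 still holds the adjacency matrix, and
  because the number of graphs, which precedes them in the output, is known only at the end.\<close>

definition Emit :: "expr \<Rightarrow> prog" where
  "Emit e = Seq (Assign 20 (Var 21) e) (Inc 21)"

definition EmitGraph :: "bool \<Rightarrow> prog" where
  "EmitGraph c = Seq (For 11 (Var 2) (Emit (Const 1))) (Seq (Emit (Const 0))
     (For 11 (Var 2) (For 12 (Var 2)
       (Seq (Separates c 11 12 15) (Seq (Separates c 12 11 16)
         (Emit (Not (Or (Eq (Var 11) (Var 12)) (Or (Var 15) (Var 16))))))))))"

text \<open>Clearing the digits at the end restores an empty bank 6, which is code 0 for the next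
  block and also keeps the zero cells that stop a carry.\<close>

definition Block :: "bool \<Rightarrow> prog" where
  "Block c = Seq (Set 7 (Const 0)) (Seq (Search c) (Seq
     (For 13 (Var 7) (EmitGraph c)) (Seq
     (Set 22 (Plus (Var 22) (Var 7))) (Seq
     (For 19 (Var 10) (Assign 6 (Plus (Cell 5 (Var 8)) (Var 19)) (Const 0)))
     (Set 8 (Plus (Var 8) (Var 3)))))))"

text \<open>Powers are formed by repeated addition. The tested values reach at most
  \<open>(n + 1) ^ (n * n)\<close>, whose bit length is polynomial in \<open>n\<close>, and only
  polynomially many additions occur.\<close>

definition BlockSize :: prog where
  "BlockSize = Seq (Set 3 (Const 1)) (For 11 (Var 2) (Seq (Set 15 (Const 1)) (Seq
     (For 12 (Plus (Var 11) (Const 1)) (For 13 (Plus (Var 11) (Const 1))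
       (Seq (Set 16 (Const 0)) (Seq
         (For 14 (Plus (Var 11) (Const 2)) (Set 16 (Plus (Var 16) (Var 15))))
         (Set 15 (Var 16))))))
     (If (Le (Var 15) (Var 2)) (Set 3 (Plus (Var 11) (Const 1))) Skip))))"

definition Init :: prog where
  "Init = Seq (While (Cell 0 (Var 2)) (Inc 2)) (Seq
     BlockSize (Seq
     (Set 23 (Plus (Var 2) (Const 1))) (Seq
     (For 11 (Var 2) (Seq (Assign 4 (Var 11) (Var 23)) (Set 23 (Plus (Var 23) (Var 2))))) (Seq
     (Set 23 (Const 0)) (Seq
     (For 11 (Var 2) (Seq (Assign 5 (Var 11) (Var 23)) (Set 23 (Plus (Var 23) (Var 3)))))
     (For 11 (Var 3) (Set 10 (Plus (Var 10) (Var 3)))))))))"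

definition Output :: prog where
  "Output = Seq (For 11 (Var 22) (Assign 0 (Var 11) (Const 1))) (Seq
     (Assign 0 (Var 22) (Const 0)) (Seq
     (For 11 (Var 21) (Assign 0 (Plus (Plus (Var 22) (Const 1)) (Var 11)) (Cell 20 (Var 11))))
     (Set 1 (Plus (Plus (Var 22) (Const 1)) (Var 21)))))"

definition Main :: "bool \<Rightarrow> prog" where
  "Main c = Seq Init (Seq (While (Less (Var 8) (Var 2)) (Block c)) Output)"

lemma ball_lessThan_Suc: "(\<forall>w<Suc i. P w) \<longleftrightarrow> (\<forall>w<i. P w) \<and> P i"
  using less_Suc_eq by auto

lemma bex_lessThan_Suc: "(\<exists>w<Suc i. P w) \<longleftrightarrow> (\<exists>w<i. P w) \<or> P i"
  using less_Suc_eq by auto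

lemma runs_If_of_bool:
  assumes "eval_expr b m = of_bool P" "P \<Longrightarrow> runs c1 m T Q" "\<not> P \<Longrightarrow> runs c2 m T Q"
  shows "runs (If b c1 c2) m (T + 1) Q"
  using assms by (cases P) auto

definition written :: "bool list \<Rightarrow> memory \<Rightarrow> bool" where
  "written w m \<longleftrightarrow> m 21 0 = length w \<and> (\<forall>i<length w. m 20 i = of_bool (w ! i))"

lemma written_cong: "written w m \<Longrightarrow> m' 20 = m 20 \<Longrightarrow> m' 21 = m 21 \<Longrightarrow> written w m'"
  by (simp add: written_def)

lemma runs_Emit:
  assumes "written w m" "eval_expr e m = of_bool b"
  shows "runs (Emit e) m 2 (\<lambda>m'. frame {20, 21} m m' \<and> written (w @ [b]) m')"
  using assms by (auto simp: Emit_def written_def frame_def nth_append)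

text \<open>The carry passes through \<open>z\<close> maximal digits and arrives at the quotient
  above them.\<close>

lemma Suc_div_power:
  assumes "0 < b" "\<And>q. q < z \<Longrightarrow> digit b N q = b - 1"
  shows "Suc N div b ^ z = Suc (N div b ^ z)"
  using assms(2)
proof (induction z)
  case (Suc z)
  have "Suc N div b ^ Suc z = Suc N div b ^ z div b"
    by (simp only: power_Suc2 div_mult2_eq)
  also have "\<dots> = Suc (N div b ^ z) div b" using Suc by simp
  also have "\<dots> = Suc (N div b ^ z div b)"
  proof -
    have "Suc (N div b ^ z mod b) = b" using Suc.prems[of z] assms(1) by (simp add: digit_def)
    then show ?thesis by (simp add: div_Suc mod_Suc)
  qed
  also have "N div b ^ z div b = N div b ^ Suc z"
    by (simp only: power_Suc2 div_mult2_eq)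
  finally show ?case .
qed simp

lemma digit_Suc_carry:
  assumes "0 < b" "\<And>q. q < z \<Longrightarrow> digit b N q = b - 1" "q < z"
  shows "digit b (Suc N) q = 0"
proof -
  have "Suc (N div b ^ q mod b) = b" using assms(1) assms(2)[OF assms(3)] by (simp add: digit_def)
  moreover have "Suc N div b ^ q = Suc (N div b ^ q)"
    by (rule Suc_div_power) (use assms in auto)
  ultimately show ?thesis by (simp add: digit_def mod_Suc)
qed

text \<open>The first digit that is not maximal absorbs the carry. The second claim is about
  quotients instead of digits so that it also covers the leading part, the number of
  functions.\<close>

lemma digit_Suc_stop:
  assumes "\<And>q. q < z \<Longrightarrow> digit b N q = b - 1" "digit b N z < b - 1"
  shows "digit b (Suc N) z = Suc (digit b N z)"
    and "\<And>q. z < q \<Longrightarrow> Suc N div b ^ q = N div b ^ q"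
proof -
  have b: "0 < b" using assms(2) by simp
  have S: "Suc N div b ^ z = Suc (N div b ^ z)" by (rule Suc_div_power[OF b assms(1)])
  have ne: "Suc (N div b ^ z mod b) \<noteq> b" using assms(2) by (simp add: digit_def)
  then show "digit b (Suc N) z = Suc (digit b N z)" by (simp add: digit_def S mod_Suc)
  fix q assume "z < q"
  then obtain d where q: "q = z + Suc d" using less_imp_Suc_add by fastforce
  have split: "M div b ^ q = M div b ^ z div b div b ^ d" for M
    by (simp only: q power_add power_Suc div_mult2_eq)
  have "Suc (N div b ^ z) div b = N div b ^ z div b" using ne by (simp add: div_Suc mod_Suc)
  then show "Suc N div b ^ q = N div b ^ q" by (simp only: split S)
qed

section \<open>Time bounds and correctness of the subprograms\<close>

definition size_time :: "nat \<Rightarrow> nat" where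
  "size_time n = n * (n * (n * ((n + 1) * 3 + 6) + 4) + 7) + 3"

definition check_time :: "nat \<Rightarrow> nat \<Rightarrow> nat" where
  "check_time n k = n * (n * (k * (n * 4 + 9) + 8) + 5) + 3"

text \<open>The power bounds the number of codes tried. It is the one factor exponential in
  \<open>k\<close>, and the choice of the block size keeps it polynomial in
  \<open>n\<close>.\<close>

definition search_time :: "nat \<Rightarrow> nat \<Rightarrow> nat" where
  "search_time n k = check_time n k + Suc k * Suc k ^ (k * k) * (k * k * 3 + 6 + check_time n k) + 1"

definition graph_time :: "nat \<Rightarrow> nat" where
  "graph_time n = n * (n * (n * 8 + 14) + 4) + n * 4 + 6"

definition block_time :: "nat \<Rightarrow> nat \<Rightarrow> nat" where
  "block_time n k = search_time n k + k * (graph_time n + 2) + k * k * 3 + 7"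

definition init_time :: "nat \<Rightarrow> nat \<Rightarrow> nat" where
  "init_time n k = size_time n + n * 10 + k * 3 + 9"

text \<open>The last summand covers at most \<open>block_count n * k\<close> graphs of
  \<open>n + 1 + n * n\<close> bits each. Its factors 4 are 3 steps for writing a bit plus 1 because
  the length of the output is charged too.\<close>

definition main_time :: "nat \<Rightarrow> nat \<Rightarrow> nat" where
  "main_time n k = init_time n k + block_count n * (block_time n k + 1) + 8 +
     (block_count n * k) * ((n + 1 + n * n) * 4 + 4)"

text \<open>The value of \<open>k\<close> stays open here: the search and the output of graphs work
  for every positive block size, and \<open>k = block_size n\<close> enters only with
  \<open>Init\<close> and \<open>Main\<close>.\<close>

locale labelled_graph =
  fixes c :: bool and G :: "nat graph" and n k :: nat
  assumes labelled: "G \<in> labelled_graphs" and card_verts: "card (verts G) = n" and k_pos: "0 < k"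
begin

lemma verts_eq: "verts G = {..<n}"
  using labelled_graph_verts(2)[OF labelled] by (simp add: card_verts)

text \<open>Adjacency is described by the result of the lookup through bank 4, which spares later
  proofs the address arithmetic of the matrix.\<close>

definition ready :: "memory \<Rightarrow> bool" where
  "ready m \<longleftrightarrow> m 2 0 = n \<and> m 3 0 = k \<and> m 10 0 = k * k \<and> (\<forall>v<n. m 5 v = v * k) \<and>
     (\<forall>w<n. \<forall>v<n. m 0 (m 4 w + v) = of_bool ({w, v} \<in> edges G))"

lemma ready_frame:
  assumes "ready m" "frame S m m'" "S \<inter> {0, 2, 3, 4, 5, 10} = {}"
  shows "ready m'"
proof -
  have "m' a = m a" if "a \<in> {0, 2, 3, 4, 5, 10}" for a
    using assms(2,3) that by (intro frameD) auto
  then show ?thesis using assms(1) by (simp add: ready_def)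
qed

lemma runs_Separates:
  assumes m: "ready m" "\<forall>v<n. m 6 (v * k + m 13 0) = h v"
    and uv: "m x 0 = u" "m y 0 = v" "u < n" "v < n"
    and xyr: "x \<in> {11, 12}" "y \<in> {11, 12}" "r \<in> {15, 16}"
  shows "runs (Separates c x y r) m (n * 4 + 5)
    (\<lambda>m'. frame {14, r} m m' \<and> m' r 0 = of_bool (separates c G h u v))"
proof -
  let ?P = "\<lambda>w. w = v \<or> {w, v} \<in> edges G \<longrightarrow> h w < h u"
  let ?m = "m(r := (m r)(0 := 1))"
  let ?I = "\<lambda>i m'. frame {14, r} m m' \<and> m' r 0 = of_bool (\<forall>w<i. ?P w)"
  have fr: "m' 0 = m 0" "m' 2 = m 2" "m' 4 = m 4" "m' 5 = m 5" "m' 6 = m 6" "m' 13 = m 13"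
    "m' x = m x" "m' y = m y" if "frame {14, r} m m'" for m'
    using that xyr by (auto simp: frame_def)
  have rd: "m 2 0 = n" "\<And>v. v < n \<Longrightarrow> m 5 v = v * k"
    "\<And>w v. w < n \<Longrightarrow> v < n \<Longrightarrow> m 0 (m 4 w + v) = of_bool ({w, v} \<in> edges G)"
    using m(1) by (auto simp: ready_def)
  have loop: "runs (For 14 (Var 2)
       (If (And (Or (Eq (Var 14) (Var y)) (Adj 14 y)) (Le (Height x) (Height 14)))
         (Set r (Const 0)) Skip)) ?m (n * (2 + 2) + 2) (?I n)"
  proof (rule runs_For)
    show "?I 0 (?m(14 := (?m 14)(0 := 0)))" using xyr by (auto simp: frame_def)
    show "eval_expr (Var 2) m' = n" if "?I i m'" for i m'
      using that fr rd by simp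
    fix i m' assume i: "i < n" and I: "?I i m'" and mi: "m' 14 0 = i"
    have r: "r \<noteq> 14" using xyr by auto
    have "eval_expr (And (Or (Eq (Var 14) (Var y)) (Adj 14 y)) (Le (Height x) (Height 14))) m'
        = of_bool (\<not> ?P i)"
      using fr[of m'] I rd i mi uv m(2) by (auto simp: Adj_def Height_def)
    then show "runs (If (And (Or (Eq (Var 14) (Var y)) (Adj 14 y)) (Le (Height x) (Height 14)))
         (Set r (Const 0)) Skip) m' 2
         (\<lambda>m'. m' 14 0 = i \<and> ?I (Suc i) (m'(14 := (m' 14)(0 := Suc i))))"
      using I r mi unfolding ball_lessThan_Suc by (auto simp: frame_def)
  qed
  have sep: "separates c G h u v \<longleftrightarrow> (\<forall>w<n. ?P w) \<and> (c \<longrightarrow> h v = 0)"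
    by (auto simp: separates_def verts_eq)
  have last: "runs (If (if c then Height y else Const 0) (Set r (Const 0)) Skip) m' 2
      (\<lambda>m'. frame {14, r} m m' \<and> m' r 0 = of_bool (separates c G h u v))" if "?I n m'" for m'
  proof -
    have "eval_expr (if c then Height y else Const 0) m' = (if c then h v else 0)"
      using fr[of m'] that rd uv m(2) by (simp add: Height_def)
    then show ?thesis using that unfolding sep by (auto simp: frame_def)
  qed
  show ?thesis
    unfolding Separates_def runs_Seq_Assign eval_expr.simps
    by (intro conjI runs_Seq[OF loop] runs_weaken[OF last]) auto
qed

text \<open>The zeros outside the window of \<open>k * k\<close> digits matter twice: they are the
  heights of the vertices outside the block, and they stop the carry in
  \<open>Increment\<close>.\<close>

definition coded :: "nat \<Rightarrow> nat \<Rightarrow> memory \<Rightarrow> bool" where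
  "coded s N m \<longleftrightarrow> m 7 0 = N div Suc k ^ (k * k) \<and> m 8 0 = s \<and>
     (\<forall>q. m 6 q = (if s * k \<le> q \<and> q < s * k + k * k then digit (Suc k) N (q - s * k) else 0))"

text \<open>With \<open>j < k\<close> the address stays among the \<open>k\<close> cells of
  \<open>v\<close>. For \<open>v\<close> outside the block these cells miss the window, and the 0
  stored there is the default of \<open>code_height\<close>.\<close>

lemma coded_height:
  assumes "coded s N m" "j < k"
  shows "m 6 (v * k + j) = code_height k s N j v"
proof -
  consider "v < s" | "s \<le> v" "v < s + k" | "s + k \<le> v" by linarith
  then show ?thesis
  proof cases
    case 1
    then have "(v + 1) * k \<le> s * k" by (intro mult_right_mono) auto
    then have "v * k + j < s * k" using assms(2) by simp
    then show ?thesis using assms(1) 1 by (simp add: coded_def code_height_def)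
  next
    case 2
    then obtain d where d: "v = s + d" "d < k" using le_Suc_ex by auto
    have "(d + 1) * k \<le> k * k" using d by (intro mult_right_mono) auto
    then have "d * k + j < k * k" using assms(2) by simp
    then show ?thesis using assms(1) d by (simp add: coded_def code_height_def algebra_simps)
  next
    case 3
    then have "(s + k) * k \<le> v * k" by (intro mult_right_mono) auto
    then have "\<not> v * k + j < s * k + k * k" by (simp add: algebra_simps)
    then show ?thesis using assms(1) 3 by (simp add: coded_def code_height_def)
  qed
qed

lemma coded_cong:
  "coded s N m \<Longrightarrow> m' 6 = m 6 \<Longrightarrow> m' 7 = m 7 \<Longrightarrow> m' 8 = m 8 \<Longrightarrow> coded s N m'"
  by (simp add: coded_def)

lemma runs_Check:
  assumes m: "ready m" "coded s N m" and K: "N div Suc k ^ (k * k) \<le> k"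
  shows "runs (Check c) m (check_time n k) (\<lambda>m'. frame {11, 12, 13, 14, 15, 17, 18} m m' \<and>
    m' 18 0 = of_bool (\<not> covers c G (block G k s) (code_heights k s N)))"
proof -
  let ?S = "{11, 12, 13, 14, 15, 17, 18}"
  let ?K = "N div Suc k ^ (k * k)"
  let ?sep = "\<lambda>j u v. separates c G (code_height k s N j) u v"
  let ?D = "\<lambda>u v. u \<noteq> v \<and> {u, v} \<notin> edges G \<and> \<not> (\<exists>j<?K. ?sep j u v)"
  let ?B = "\<lambda>u. s \<le> u \<and> u < s + k \<and> (\<exists>v<n. ?D u v)"
  have cov: "covers c G (block G k s) (code_heights k s N) \<longleftrightarrow> \<not> (\<exists>u<n. ?B u)"
    unfolding covers_def block_def code_heights_def verts_eq
    by (simp add: Ball_def Bex_def image_iff) blast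
  have fr: "m' 0 = m 0" "m' 2 = m 2" "m' 3 = m 3" "m' 4 = m 4" "m' 5 = m 5" "m' 6 = m 6"
    "m' 7 = m 7" "m' 8 = m 8" if "frame ?S m m'" for m'
    using that by (auto simp: frame_def)
  have rd: "m 2 0 = n" "m 3 0 = k" "m 7 0 = ?K" "m 8 0 = s"
    "\<And>w v. w < n \<Longrightarrow> v < n \<Longrightarrow> m 0 (m 4 w + v) = of_bool ({w, v} \<in> edges G)"
    using m by (auto simp: ready_def coded_def)
  \<comment> \<open>Cell 18 is not reset between rows or pairs, so the inner invariants carry the
    verdict on all earlier rows as a disjunct; cell 17 is fresh for each pair.\<close>
  define IU where "IU = (\<lambda>i m'. frame ?S m m' \<and> m' 18 0 = of_bool (\<exists>u<i. ?B u))"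
  define IV where "IV = (\<lambda>u i m'. frame ?S m m' \<and> m' 11 0 = u \<and>
      m' 18 0 = of_bool ((\<exists>u'<u. ?B u') \<or> (\<exists>v<i. ?D u v)))"
  define IJ where "IJ = (\<lambda>u v i m'. frame ?S m m' \<and> m' 11 0 = u \<and> m' 12 0 = v \<and>
      m' 18 0 = of_bool ((\<exists>u'<u. ?B u') \<or> (\<exists>v'<v. ?D u v')) \<and>
      m' 17 0 = of_bool (\<exists>j<i. ?sep j u v))"
  have loopJ: "runs (For 13 (Var 7) (Seq (Separates c 11 12 15) (If (Var 15) (Set 17 (Const 1)) Skip)))
      m1 (k * (n * 4 + 9) + 2) (IJ u v ?K)"
    if start: "IJ u v 0 m1" and uv: "u < n" "v < n" for u v m1
  proof -
    have "runs (For 13 (Var 7) (Seq (Separates c 11 12 15) (If (Var 15) (Set 17 (Const 1)) Skip)))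
      m1 (?K * (n * 4 + 7 + 2) + 2) (IJ u v ?K)"
    proof (rule runs_For)
      show "IJ u v 0 (m1(13 := (m1 13)(0 := 0)))" using start by (auto simp: IJ_def frame_def)
      show "eval_expr (Var 7) m' = ?K" if "IJ u v i m'" for i m'
        using that fr[of m'] rd by (simp add: IJ_def)
      fix i m' assume i: "i < ?K" and I: "IJ u v i m'" and mi: "m' 13 0 = i"
      have f: "frame ?S m m'" using I by (simp add: IJ_def)
      have rdy: "ready m'" by (rule ready_frame[OF m(1) f]) simp
      have "coded s N m'" by (rule coded_cong[OF m(2)]) (use fr[OF f] in auto)
      then have h: "\<forall>v<n. m' 6 (v * k + m' 13 0) = code_height k s N i v"
        using coded_height i K mi by auto
      have sep: "runs (Separates c 11 12 15) m' (n * 4 + 5)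
          (\<lambda>m''. frame {14, 15} m' m'' \<and> m'' 15 0 = of_bool (?sep i u v))"
        by (rule runs_Separates[OF rdy h]) (use I uv in \<open>auto simp: IJ_def\<close>)
      show "runs (Seq (Separates c 11 12 15) (If (Var 15) (Set 17 (Const 1)) Skip)) m' (n * 4 + 7)
          (\<lambda>m'. m' 13 0 = i \<and> IJ u v (Suc i) (m'(13 := (m' 13)(0 := Suc i))))"
      proof (rule runs_Seq[OF sep])
        fix m2 assume m2: "frame {14, 15} m' m2 \<and> m2 15 0 = of_bool (?sep i u v)"
        have f2: "frame ?S m m2" using frame_trans[OF f] m2 by blast
        have m2': "m2 11 = m' 11" "m2 12 = m' 12" "m2 13 = m' 13" "m2 17 = m' 17" "m2 18 = m' 18"
          using m2 by (auto simp: frame_def)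
        have "runs (If (Var 15) (Set 17 (Const 1)) Skip) m2 (1 + 1)
          (\<lambda>m'. m' 13 0 = i \<and> IJ u v (Suc i) (m'(13 := (m' 13)(0 := Suc i))))"
          by (rule runs_If_of_bool[where P = "?sep i u v"])
            (use m2 f2 m2' I mi in \<open>auto simp: IJ_def bex_lessThan_Suc intro!: frame_update\<close>)
        then show "runs (If (Var 15) (Set 17 (Const 1)) Skip) m2 (n * 4 + 7 - (n * 4 + 5))
          (\<lambda>m'. m' 13 0 = i \<and> IJ u v (Suc i) (m'(13 := (m' 13)(0 := Suc i))))"
            by (rule runs_weaken) auto
      qed simp
    qed
    then show ?thesis
      by (rule runs_weaken) (use mult_le_mono1[OF K, of "n * 4 + 9"] in \<open>auto simp: algebra_simps\<close>)
  qed
  let ?TV = "n * (k * (n * 4 + 9) + 8) + 2"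
  have loopV: "runs (For 12 (Var 2) (If (Or (Eq (Var 11) (Var 12)) (Adj 11 12)) Skip
         (Seq (Set 17 (Const 0)) (Seq
           (For 13 (Var 7) (Seq (Separates c 11 12 15) (If (Var 15) (Set 17 (Const 1)) Skip)))
           (If (Var 17) Skip (Set 18 (Const 1))))))) m1 ?TV (IV u n)"
    if start: "IV u 0 m1" and u: "u < n" for u m1
  proof -
    have "runs (For 12 (Var 2) (If (Or (Eq (Var 11) (Var 12)) (Adj 11 12)) Skip
         (Seq (Set 17 (Const 0)) (Seq
           (For 13 (Var 7) (Seq (Separates c 11 12 15) (If (Var 15) (Set 17 (Const 1)) Skip)))
           (If (Var 17) Skip (Set 18 (Const 1))))))) m1 (n * ((k * (n * 4 + 9) + 2 + 3 + 1) + 2) + 2) (IV u n)"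
    proof (rule runs_For)
      show "IV u 0 (m1(12 := (m1 12)(0 := 0)))" using start by (auto simp: IV_def frame_def)
      show "eval_expr (Var 2) m' = n" if "IV u i m'" for i m'
        using that fr[of m'] rd by (simp add: IV_def)
      fix v m' assume v: "v < n" and I: "IV u v m'" and mv: "m' 12 0 = v"
      have f: "frame ?S m m'" using I by (simp add: IV_def)
      let ?Q = "\<lambda>m'. m' 12 0 = v \<and> IV u (Suc v) (m'(12 := (m' 12)(0 := Suc v)))"
      show "runs (If (Or (Eq (Var 11) (Var 12)) (Adj 11 12)) Skip
         (Seq (Set 17 (Const 0)) (Seq
           (For 13 (Var 7) (Seq (Separates c 11 12 15) (If (Var 15) (Set 17 (Const 1)) Skip)))
           (If (Var 17) Skip (Set 18 (Const 1)))))) m' (k * (n * 4 + 9) + 2 + 3 + 1) ?Q"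
      proof (rule runs_If_of_bool[where P = "u = v \<or> {u, v} \<in> edges G"])
        show "eval_expr (Or (Eq (Var 11) (Var 12)) (Adj 11 12)) m' =
            of_bool (u = v \<or> {u, v} \<in> edges G)"
          using I mv fr[OF f] rd u v by (auto simp: IV_def Adj_def)
        show "runs Skip m' (k * (n * 4 + 9) + 2 + 3) ?Q" if "u = v \<or> {u, v} \<in> edges G"
          using that I mv by (auto simp: IV_def bex_lessThan_Suc frame_def)
        assume non: "\<not> (u = v \<or> {u, v} \<in> edges G)"
        let ?m = "m'(17 := (m' 17)(0 := 0))"
        have J0: "IJ u v 0 ?m" using I mv by (auto simp: IJ_def IV_def frame_def)
        have "runs (Seq
           (For 13 (Var 7) (Seq (Separates c 11 12 15) (If (Var 15) (Set 17 (Const 1)) Skip)))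
           (If (Var 17) Skip (Set 18 (Const 1)))) ?m (k * (n * 4 + 9) + 2 + 2) ?Q"
        proof (rule runs_Seq[OF loopJ[OF J0 u v]])
          fix m2 assume J: "IJ u v ?K m2"
          have "runs (If (Var 17) Skip (Set 18 (Const 1))) m2 (1 + 1) ?Q"
            by (rule runs_If_of_bool[where P = "\<exists>j<?K. ?sep j u v"])
              (use J non in \<open>auto simp: IJ_def IV_def bex_lessThan_Suc intro!: frame_update\<close>)
          then show "runs (If (Var 17) Skip (Set 18 (Const 1))) m2
            (k * (n * 4 + 9) + 2 + 2 - (k * (n * 4 + 9) + 2)) ?Q" by (rule runs_weaken) auto
        qed simp
        then show "runs (Seq (Set 17 (Const 0)) (Seq
           (For 13 (Var 7) (Seq (Separates c 11 12 15) (If (Var 15) (Set 17 (Const 1)) Skip)))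
           (If (Var 17) Skip (Set 18 (Const 1))))) m' (k * (n * 4 + 9) + 2 + 3) ?Q"
          unfolding runs_Seq_Assign eval_expr.simps
          by (intro conjI) (simp, erule runs_weaken, auto)
      qed
    qed
    then show ?thesis by (rule runs_weaken) auto
  qed
  have loopU: "runs (For 11 (Var 2) (If (And (Le (Var 8) (Var 11)) (Less (Var 11) (Plus (Var 8) (Var 3))))
       (For 12 (Var 2) (If (Or (Eq (Var 11) (Var 12)) (Adj 11 12)) Skip
         (Seq (Set 17 (Const 0)) (Seq
           (For 13 (Var 7) (Seq (Separates c 11 12 15) (If (Var 15) (Set 17 (Const 1)) Skip)))
           (If (Var 17) Skip (Set 18 (Const 1)))))))
       Skip)) (m(18 := (m 18)(0 := 0))) (n * ((?TV + 1) + 2) + 2) (IU n)"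
  proof (rule runs_For)
    show "IU 0 ((m(18 := (m 18)(0 := 0)))(11 := ((m(18 := (m 18)(0 := 0))) 11)(0 := 0)))"
      by (auto simp: IU_def frame_def)
    show "eval_expr (Var 2) m' = n" if "IU i m'" for i m'
      using that fr[of m'] rd by (simp add: IU_def)
    fix u m' assume u: "u < n" and I: "IU u m'" and mu: "m' 11 0 = u"
    have f: "frame ?S m m'" using I by (simp add: IU_def)
    show "runs (If (And (Le (Var 8) (Var 11)) (Less (Var 11) (Plus (Var 8) (Var 3))))
       (For 12 (Var 2) (If (Or (Eq (Var 11) (Var 12)) (Adj 11 12)) Skip
         (Seq (Set 17 (Const 0)) (Seq
           (For 13 (Var 7) (Seq (Separates c 11 12 15) (If (Var 15) (Set 17 (Const 1)) Skip)))
           (If (Var 17) Skip (Set 18 (Const 1)))))))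
       Skip) m' (?TV + 1) (\<lambda>m'. m' 11 0 = u \<and> IU (Suc u) (m'(11 := (m' 11)(0 := Suc u))))"
    proof (rule runs_If_of_bool[where P = "s \<le> u \<and> u < s + k"])
      show "eval_expr (And (Le (Var 8) (Var 11)) (Less (Var 11) (Plus (Var 8) (Var 3)))) m' =
          of_bool (s \<le> u \<and> u < s + k)"
        using mu fr[OF f] rd by simp
      assume *: "s \<le> u \<and> u < s + k"
      have "IV u 0 m'" using I mu by (simp add: IU_def IV_def)
      from runs_weaken[OF loopV[OF this u] order_refl]
      show "runs (For 12 (Var 2) (If (Or (Eq (Var 11) (Var 12)) (Adj 11 12)) Skip
         (Seq (Set 17 (Const 0)) (Seq
           (For 13 (Var 7) (Seq (Separates c 11 12 15) (If (Var 15) (Set 17 (Const 1)) Skip)))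
           (If (Var 17) Skip (Set 18 (Const 1)))))))
         m' ?TV (\<lambda>m'. m' 11 0 = u \<and> IU (Suc u) (m'(11 := (m' 11)(0 := Suc u))))"
        by (rule runs_weaken) (use * in \<open>auto simp: IU_def IV_def bex_lessThan_Suc intro!: frame_update\<close>)
    next
      assume "\<not> (s \<le> u \<and> u < s + k)"
      then show "runs Skip m' ?TV (\<lambda>m'. m' 11 0 = u \<and> IU (Suc u) (m'(11 := (m' 11)(0 := Suc u))))"
        using I mu by (auto simp: IU_def bex_lessThan_Suc intro!: frame_update)
    qed
  qed
  show ?thesis
    unfolding Check_def runs_Seq_Assign eval_expr.simps
  proof (intro conjI runs_weaken[OF loopU])
    show "1 \<le> check_time n k" by (simp add: check_time_def)
    show "n * ((?TV + 1) + 2) + 2 \<le> check_time n k - 1"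
      by (simp add: check_time_def algebra_simps)
  qed (auto simp: IU_def cov)
qed

lemma runs_Increment:
  assumes m: "ready m" "coded s N m" and s: "s < n"
  shows "runs Increment m (k * k * 3 + 5) (\<lambda>m'. frame {6, 7, 19} m m' \<and> coded s (Suc N) m')"
proof -
  let ?b = "Suc k"
  have rd: "m 3 0 = k" "m 5 s = s * k" "m 10 0 = k * k" "m 8 0 = s" "m 7 0 = N div ?b ^ (k * k)"
    and D: "\<And>q. m 6 q = (if s * k \<le> q \<and> q < s * k + k * k then digit ?b N (q - s * k) else 0)"
    using m s by (auto simp: ready_def coded_def)
  \<comment> \<open>The position where the carry stops: the first digit below its maximum
    \<open>k\<close>, or \<open>k * k\<close> if all digits are maximal.\<close>
  define z where "z = (LEAST z. z = k * k \<or> digit ?b N z \<noteq> k)"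
  have z: "z = k * k \<or> digit ?b N z \<noteq> k"
    unfolding z_def by (rule LeastI[of _ "k * k"]) simp
  have z_le: "z \<le> k * k" unfolding z_def by (rule Least_le) simp
  have below: "digit ?b N q = ?b - 1" if "q < z" for q
    using not_less_Least[OF that[unfolded z_def]] by simp
  have dig_le: "digit ?b N q \<le> k" for q
    by (simp add: digit_def less_Suc_eq_le[symmetric])
  define I where "I = (\<lambda>i m'. frame {6, 19} m m' \<and> m' 19 0 = s * k + i \<and>
      (\<forall>q. m' 6 q = (if s * k \<le> q \<and> q < s * k + i then 0 else m 6 q)))"
  have loop: "runs (While (Le (Var 3) (Cell 6 (Var 19))) (Seq (Assign 6 (Var 19) (Const 0)) (Inc 19)))
      (m(19 := (m 19)(0 := s * k))) (z * (2 + 1) + 1) (I z)"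
  proof (rule runs_While)
    show "I 0 (m(19 := (m 19)(0 := s * k)))" by (auto simp: I_def frame_def)
  next
    fix i m' assume "i < z" "I i m'"
    moreover have "m' 3 = m 3" using \<open>I i m'\<close> by (simp add: I_def frame_def)
    ultimately show "eval_expr (Le (Var 3) (Cell 6 (Var 19))) m' \<noteq> 0"
      using rd D below[of i] z_le by (simp add: I_def)
  next
    fix i m' assume "i < z" "I i m'"
    then show "runs (Seq (Assign 6 (Var 19) (Const 0)) (Inc 19)) m' 2 (I (Suc i))"
      by (auto simp: I_def frame_def)
  next
    fix m' assume I: "I z m'"
    moreover have "m' 3 = m 3" using I by (simp add: I_def frame_def)
    \<comment> \<open>For \<open>z = k * k\<close> this is the zero cell behind the window, and the
      claim is \<open>0 < k\<close>.\<close>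
    moreover have "m 6 (s * k + z) < k" using z dig_le[of z] k_pos by (auto simp: D)
    ultimately show "eval_expr (Le (Var 3) (Cell 6 (Var 19))) m' = 0"
      using rd by (simp add: I_def)
  qed
  have last: "runs (If (Less (Var 19) (Plus (Cell 5 (Var 8)) (Var 10)))
         (Assign 6 (Var 19) (Plus (Cell 6 (Var 19)) (Const 1))) (Inc 7)) m' (1 + 1)
      (\<lambda>m'. frame {6, 7, 19} m m' \<and> coded s (Suc N) m')" if I: "I z m'" for m'
  proof (rule runs_If_of_bool[where P = "z < k * k"])
    have eq: "m' 5 = m 5" "m' 7 = m 7" "m' 8 = m 8" "m' 10 = m 10" "m' 19 0 = s * k + z"
      and D': "\<And>q. m' 6 q = (if s * k \<le> q \<and> q < s * k + z then 0 else m 6 q)"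
      using I by (auto simp: I_def frame_def)
    have fr: "frame {6, 7, 19} m m'" using I by (auto simp: I_def frame_def)
    show "eval_expr (Less (Var 19) (Plus (Cell 5 (Var 8)) (Var 10))) m' = of_bool (z < k * k)"
      using eq rd by simp
    have zero: "digit ?b (Suc N) q = 0" if "q < z" for q
      by (rule digit_Suc_carry[OF _ below that]) auto
    show "runs (Assign 6 (Var 19) (Plus (Cell 6 (Var 19)) (Const 1))) m' 1
        (\<lambda>m'. frame {6, 7, 19} m m' \<and> coded s (Suc N) m')" if "z < k * k"
    proof -
      have stop: "digit ?b N z < ?b - 1" using z that dig_le[of z] by auto
      have dz: "digit ?b (Suc N) z = Suc (digit ?b N z)"
        by (rule digit_Suc_stop(1)[OF below stop])
      have up: "Suc N div ?b ^ q = N div ?b ^ q" if "z < q" for q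
        by (rule digit_Suc_stop(2)[OF below stop that])
      have dq: "digit ?b (Suc N) q = digit ?b N q" if "z < q" for q
        using up[OF that] by (simp add: digit_def)
      have upd: "((m' 6)(s * k + z := Suc (m' 6 (s * k + z)))) q =
          (if s * k \<le> q \<and> q < s * k + k * k then digit ?b (Suc N) (q - s * k) else 0)" for q
      proof -
        consider "q < s * k" | p where "q = s * k + p" using le_Suc_ex not_less by blast
        then show ?thesis
        proof cases
          case 1
          then show ?thesis by (simp add: D D')
        next
          case (2 p)
          consider "p < z" | "p = z" | "z < p" by linarith
          then show ?thesis
            by cases (use 2 that in \<open>simp_all add: D D' zero dz dq\<close>)
        qed
      qed
      have "coded s (Suc N) (m'(6 := (m' 6)(s * k + z := Suc (m' 6 (s * k + z)))))"
        unfolding coded_def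
      proof (intro conjI allI)
        fix q show "(m'(6 := (m' 6)(s * k + z := Suc (m' 6 (s * k + z))))) 6 q =
          (if s * k \<le> q \<and> q < s * k + k * k then digit ?b (Suc N) (q - s * k) else 0)"
          unfolding fun_upd_same by (rule upd)
      qed (use eq rd up[OF that] in simp_all)
      then show ?thesis
        using frame_update[OF fr, of 6] eq by simp
    qed
    show "runs (Inc 7) m' 1 (\<lambda>m'. frame {6, 7, 19} m m' \<and> coded s (Suc N) m')" if "\<not> z < k * k"
    proof -
      \<comment> \<open>All digits overflow, so they become 0 and the increment goes to the count in
        cell 7.\<close>
      have zk: "z = k * k" using that z_le by simp
      have "Suc N div ?b ^ (k * k) = Suc (N div ?b ^ (k * k))"
        using Suc_div_power[OF _ below] unfolding zk by simp
      moreover have "m' 6 q =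
          (if s * k \<le> q \<and> q < s * k + k * k then digit ?b (Suc N) (q - s * k) else 0)" for q
        using zero[of "q - s * k"] by (auto simp: D D' zk)
      ultimately show ?thesis
        using fr eq rd by (simp add: coded_def frame_def)
    qed
  qed
  have "eval_expr (Cell 5 (Var 8)) m = s * k" using rd by simp
  then have "runs (Seq (Set 19 (Cell 5 (Var 8)))
     (Seq (While (Le (Var 3) (Cell 6 (Var 19))) (Seq (Assign 6 (Var 19) (Const 0)) (Inc 19)))
       (If (Less (Var 19) (Plus (Cell 5 (Var 8)) (Var 10)))
         (Assign 6 (Var 19) (Plus (Cell 6 (Var 19)) (Const 1))) (Inc 7)))) m (z * 3 + 4)
     (\<lambda>m'. frame {6, 7, 19} m m' \<and> coded s (Suc N) m')"
    unfolding runs_Seq_Assign eval_expr.simps(1)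
    by (intro conjI) (simp, simp only:, rule runs_Seq[OF loop], simp, rule runs_weaken[OF last], auto)
  then show ?thesis unfolding Increment_def
    by (rule runs_weaken) (use z_le in auto)
qed

text \<open>The leading part of the least code is at most \<open>k\<close>. This bounds the number
  of codes the search passes through.\<close>

lemma best_code_le: "best_code c G k s \<le> Suc k * Suc k ^ (k * k)"
proof -
  have "best_code c G k s < Suc (best_code c G k s div Suc k ^ (k * k)) * Suc k ^ (k * k)"
    using dividend_less_div_times[of "Suc k ^ (k * k)" "best_code c G k s"] by simp
  also have "\<dots> \<le> Suc k * Suc k ^ (k * k)"
    using best_code_count[OF k_pos, of c G s] by (intro mult_right_mono) auto
  finally show ?thesis by simp
qed

text \<open>All codes below \<open>best_code\<close> fail by minimality, so the loop makes exactly
  \<open>best_code\<close> passes starting from code 0. Division is monotone, hence every code on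
  the way has a count of at most \<open>k\<close>, as \<open>runs_Check\<close> requires.\<close>

lemma runs_Search:
  assumes m: "ready m" "coded s 0 m" and s: "s < n"
  shows "runs (Search c) m (search_time n k)
    (\<lambda>m'. frame {6, 7, 11, 12, 13, 14, 15, 17, 18, 19} m m' \<and> coded s (best_code c G k s) m')"
proof -
  let ?S = "{6, 7, 11, 12, 13, 14, 15, 17, 18, 19}"
  let ?good = "\<lambda>N. covers c G (block G k s) (code_heights k s N)"
  let ?M = "best_code c G k s"
  define I where "I = (\<lambda>N m'. frame ?S m m' \<and> coded s N m' \<and> m' 18 0 = of_bool (\<not> ?good N))"
  have count: "N div Suc k ^ (k * k) \<le> k" if "N \<le> ?M" for N
    using div_le_mono[OF that] best_code_count[OF k_pos, of c G s] le_trans by blast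
  have check: "runs (Check c) m1 (check_time n k) (I N)"
    if "frame ?S m m1" "coded s N m1" "N \<le> ?M" for m1 N
  proof (rule runs_weaken[OF runs_Check[OF _ that(2) count[OF that(3)]] order_refl])
    show "ready m1" by (rule ready_frame[OF m(1) that(1)]) simp
    fix m2 assume m2: "frame {11, 12, 13, 14, 15, 17, 18} m1 m2 \<and> m2 18 0 = of_bool (\<not> ?good N)"
    have "frame ?S m m2" by (rule frame_trans[OF that(1)]) (use m2 in auto)
    moreover have "coded s N m2"
      by (rule coded_cong[OF that(2)]) (use m2 in \<open>auto simp: frame_def\<close>)
    ultimately show "I N m2" using m2 by (simp add: I_def)
  qed
  show ?thesis
    unfolding Search_def
  proof (rule runs_Seq[OF check[OF frame_refl m(2)]])
    fix m1 assume I0: "I 0 m1"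
    have "runs (While (Var 18) (Seq Increment (Check c))) m1
        (?M * (k * k * 3 + 5 + check_time n k + 1) + 1) (I ?M)"
    proof (rule runs_While[where I = I, OF I0])
      fix N m' assume N: "N < ?M" and I: "I N m'"
      have "\<not> ?good N" using not_less_Least N unfolding best_code_def by blast
      then show "eval_expr (Var 18) m' \<noteq> 0" using I by (simp add: I_def)
      have f: "frame ?S m m'" using I by (simp add: I_def)
      have rdy: "ready m'" by (rule ready_frame[OF m(1) f]) simp
      have cd: "coded s N m'" using I by (simp add: I_def)
      show "runs (Seq Increment (Check c)) m' (k * k * 3 + 5 + check_time n k) (I (Suc N))"
      proof (rule runs_Seq[OF runs_Increment[OF rdy cd s]])
        fix m2 assume m2: "frame {6, 7, 19} m' m2 \<and> coded s (Suc N) m2"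
        have "frame ?S m m2" by (rule frame_trans[OF f]) (use m2 in auto)
        from check[OF this, of "Suc N"] m2 N
        show "runs (Check c) m2 (k * k * 3 + 5 + check_time n k - (k * k * 3 + 5)) (I (Suc N))" by simp
      qed simp
    next
      fix m' assume "I ?M m'"
      then show "eval_expr (Var 18) m' = 0"
        using covers_best_code[OF k_pos, of c G s] by (simp add: I_def)
    qed
    then show "runs (While (Var 18) (Seq Increment (Check c))) m1 (search_time n k - check_time n k)
        (\<lambda>m'. frame ?S m m' \<and> coded s ?M m')"
    proof (rule runs_weaken)
      show "?M * (k * k * 3 + 5 + check_time n k + 1) + 1 \<le> search_time n k - check_time n k"
        using mult_le_mono1[OF best_code_le[of s], of "k * k * 3 + 6 + check_time n k"]
        by (simp add: search_time_def add_ac)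
    qed (simp add: I_def)
  qed (simp_all add: search_time_def)
qed

end

lemma length_concat_map_upt: "length (concat (map (\<lambda>i. map (f i) [0..<a]) [0..<b])) = b * a"
  by (induction b) auto

context labelled_graph
begin

definition graph_bits :: "(nat \<Rightarrow> nat) \<Rightarrow> bool list" where
  "graph_bits h = encode_graph (height_graph c G h)"

lemma graph_bits_eq:
  "graph_bits h = replicate n True @ [False] @ concat (map (\<lambda>u. map (\<lambda>v.
     {u, v} \<in> edges (height_graph c G h)) [0..<n]) [0..<n])"
  by (simp add: graph_bits_def encode_graph_def card_verts)

lemma length_graph_bits: "length (graph_bits h) = n + 1 + n * n"
  by (simp add: graph_bits_eq length_concat_map_upt)

lemma runs_EmitGraph:
  assumes m: "ready m" "\<forall>v<n. m 6 (v * k + m 13 0) = h v" "written w m"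
  shows "runs (EmitGraph c) m (graph_time n)
    (\<lambda>m'. frame {11, 12, 14, 15, 16, 20, 21} m m' \<and> written (w @ graph_bits h) m')"
proof -
  let ?S = "{11, 12, 14, 15, 16, 20, 21}"
  let ?e = "\<lambda>u v. {u, v} \<in> edges (height_graph c G h)"
  have fr: "m' 2 0 = n" "m' 6 = m 6" "m' 13 = m 13" "ready m'" if f: "frame ?S m m'" for m'
  proof -
    show "ready m'" by (rule ready_frame[OF m(1) f]) simp
    then show "m' 2 0 = n" by (simp add: ready_def)
    show "m' 6 = m 6" "m' 13 = m 13" using f by (simp_all add: frame_def)
  qed
  have emit: "runs (Emit e) m' 2 (\<lambda>m''. frame {20, 21} m' m'' \<and> frame ?S m m'' \<and> written (w' @ [b]) m'')"
    if "frame ?S m m'" "written w' m'" "eval_expr e m' = of_bool b" for e m' w' b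
    by (rule runs_weaken[OF runs_Emit[OF that(2,3)]]) (auto intro: frame_trans[OF that(1)])
  define IA where "IA = (\<lambda>i m'. frame ?S m m' \<and> written (w @ replicate i True) m')"
  have loopA: "runs (For 11 (Var 2) (Emit (Const 1))) m (n * (2 + 2) + 2) (IA n)"
  proof (rule runs_For)
    show "IA 0 (m(11 := (m 11)(0 := 0)))"
      using m(3) by (auto simp: IA_def frame_def written_def)
    show "eval_expr (Var 2) m' = n" if "IA i m'" for i m'
      using that fr by (simp add: IA_def)
    fix i m' assume "i < n" and I: "IA i m'" and mi: "m' 11 0 = i"
    show "runs (Emit (Const 1)) m' 2
        (\<lambda>m'. m' 11 0 = i \<and> IA (Suc i) (m'(11 := (m' 11)(0 := Suc i))))"
      by (rule runs_weaken[OF emit[of m' "w @ replicate i True" "Const 1" True]])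
        (use I mi in \<open>auto simp: IA_def frame_def written_def replicate_append_same[symmetric]\<close>)
  qed
  let ?w = "w @ replicate n True @ [False]"
  define IU where "IU = (\<lambda>i m'. frame ?S m m' \<and>
      written (?w @ concat (map (\<lambda>u. map (?e u) [0..<n]) [0..<i])) m')"
  define IV where "IV = (\<lambda>u i m'. frame ?S m m' \<and> m' 11 0 = u \<and>
      written (?w @ concat (map (\<lambda>u. map (?e u) [0..<n]) [0..<u]) @ map (?e u) [0..<i]) m')"
  let ?body = "Seq (Separates c 11 12 15) (Seq (Separates c 12 11 16)
         (Emit (Not (Or (Eq (Var 11) (Var 12)) (Or (Var 15) (Var 16))))))"
  have loopV: "runs (For 12 (Var 2) ?body) m1 (n * ((n * 8 + 12) + 2) + 2) (IV u n)"
    if start: "IV u 0 m1" and u: "u < n" for u m1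
  proof (rule runs_For)
    show "IV u 0 (m1(12 := (m1 12)(0 := 0)))"
      using start by (auto simp: IV_def frame_def written_def)
    show "eval_expr (Var 2) m' = n" if "IV u i m'" for i m'
      using that fr by (simp add: IV_def)
    fix v m' assume v: "v < n" and I: "IV u v m'" and mv: "m' 12 0 = v"
    let ?w' = "?w @ concat (map (\<lambda>u. map (?e u) [0..<n]) [0..<u]) @ map (?e u) [0..<v]"
    have f: "frame ?S m m'" "m' 11 0 = u" "written ?w' m'" using I by (simp_all add: IV_def)
    have "runs (Separates c 11 12 15) m' (n * 4 + 5)
        (\<lambda>m''. frame {14, 15} m' m'' \<and> m'' 15 0 = of_bool (separates c G h u v))"
      by (rule runs_Separates) (use fr[OF f(1)] f(2) mv u v m(2) in auto)
    then show "runs ?body m' (n * 8 + 12)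
        (\<lambda>m'. m' 12 0 = v \<and> IV u (Suc v) (m'(12 := (m' 12)(0 := Suc v))))"
    proof (rule runs_Seq)
      fix m1 assume m1: "frame {14, 15} m' m1 \<and> m1 15 0 = of_bool (separates c G h u v)"
      have f1: "frame ?S m m1" by (rule frame_trans[OF f(1)]) (use m1 in auto)
      have m1': "m1 11 = m' 11" "m1 12 = m' 12" "m1 20 = m' 20" "m1 21 = m' 21"
        using m1 by (auto simp: frame_def)
      have "runs (Separates c 12 11 16) m1 (n * 4 + 5)
          (\<lambda>m''. frame {14, 16} m1 m'' \<and> m'' 16 0 = of_bool (separates c G h v u))"
        by (rule runs_Separates) (use fr[OF f1] f(2) m1' mv u v m(2) in auto)
      then show "runs (Seq (Separates c 12 11 16)
         (Emit (Not (Or (Eq (Var 11) (Var 12)) (Or (Var 15) (Var 16)))))) m1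
         (n * 8 + 12 - (n * 4 + 5))
         (\<lambda>m'. m' 12 0 = v \<and> IV u (Suc v) (m'(12 := (m' 12)(0 := Suc v))))"
      proof (rule runs_Seq)
        fix m2 assume m2: "frame {14, 16} m1 m2 \<and> m2 16 0 = of_bool (separates c G h v u)"
        have f2: "frame ?S m m2" by (rule frame_trans[OF f1]) (use m2 in auto)
        have m2': "m2 11 = m1 11" "m2 12 = m1 12" "m2 15 = m1 15" "m2 20 = m1 20" "m2 21 = m1 21"
          using m2 by (auto simp: frame_def)
        have "written ?w' m2" by (rule written_cong[OF f(3)]) (use m1' m2' in auto)
        \<comment> \<open>The equality test puts 0 on the diagonal of the matrix, where
          \<open>{u, u}\<close> is not an edge.\<close>
        moreover have "eval_expr (Not (Or (Eq (Var 11) (Var 12)) (Or (Var 15) (Var 16)))) m2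
            = of_bool (?e u v)"
          using m1 m2 m1' m2' f(2) mv u v by (simp add: edge_height_graph_iff verts_eq)
        ultimately have "runs (Emit (Not (Or (Eq (Var 11) (Var 12)) (Or (Var 15) (Var 16))))) m2 2
            (\<lambda>m''. frame {20, 21} m2 m'' \<and> frame ?S m m'' \<and> written (?w' @ [?e u v]) m'')"
          by (rule emit[OF f2])
        then show "runs (Emit (Not (Or (Eq (Var 11) (Var 12)) (Or (Var 15) (Var 16))))) m2
            (n * 8 + 12 - (n * 4 + 5) - (n * 4 + 5))
            (\<lambda>m'. m' 12 0 = v \<and> IV u (Suc v) (m'(12 := (m' 12)(0 := Suc v))))"
        proof (rule runs_weaken)
          fix m3 assume m3: "frame {20, 21} m2 m3 \<and> frame ?S m m3 \<and> written (?w' @ [?e u v]) m3"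
          then have "m3 11 = m2 11" "m3 12 = m2 12" by (auto simp: frame_def)
          moreover have "written (?w' @ [?e u v]) (m3(12 := (m3 12)(0 := Suc v)))"
            using m3 by (auto simp: written_def)
          ultimately show "m3 12 0 = v \<and> IV u (Suc v) (m3(12 := (m3 12)(0 := Suc v)))"
            using m3 m1' m2' f(2) mv by (auto simp: IV_def intro: frame_update)
        qed simp
      qed simp
    qed simp
  qed
  have loopU: "runs (For 11 (Var 2) (For 12 (Var 2) ?body)) m1
      (n * ((n * ((n * 8 + 12) + 2) + 2) + 2) + 2) (IU n)"
    if start: "IU 0 m1" for m1
  proof (rule runs_For)
    show "IU 0 (m1(11 := (m1 11)(0 := 0)))"
      using start by (auto simp: IU_def frame_def written_def)
    show "eval_expr (Var 2) m' = n" if "IU i m'" for i m'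
      using that fr by (simp add: IU_def)
    fix u m' assume u: "u < n" and I: "IU u m'" and mu: "m' 11 0 = u"
    have "IV u 0 m'" using I mu by (simp add: IU_def IV_def)
    from loopV[OF this u] show "runs (For 12 (Var 2) ?body) m' (n * ((n * 8 + 12) + 2) + 2)
        (\<lambda>m'. m' 11 0 = u \<and> IU (Suc u) (m'(11 := (m' 11)(0 := Suc u))))"
    proof (rule runs_weaken)
      fix m2 assume I2: "IV u n m2"
      have "written (?w @ concat (map (\<lambda>u. map (?e u) [0..<n]) [0..<Suc u]))
          (m2(11 := (m2 11)(0 := Suc u)))"
        using I2 by (simp add: IV_def written_def)
      then show "m2 11 0 = u \<and> IU (Suc u) (m2(11 := (m2 11)(0 := Suc u)))"
        using I2 by (auto simp: IU_def IV_def intro: frame_update)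
    qed simp
  qed
  show ?thesis
    unfolding EmitGraph_def
  proof (rule runs_Seq[OF loopA])
    fix m1 assume I: "IA n m1"
    have "runs (Emit (Const 0)) m1 2 (\<lambda>m''. frame {20, 21} m1 m'' \<and> frame ?S m m'' \<and>
        written ((w @ replicate n True) @ [False]) m'')"
      by (rule emit) (use I in \<open>auto simp: IA_def\<close>)
    then show "runs (Seq (Emit (Const 0)) (For 11 (Var 2) (For 12 (Var 2) ?body))) m1
        (graph_time n - (n * (2 + 2) + 2))
        (\<lambda>m'. frame ?S m m' \<and> written (w @ graph_bits h) m')"
    proof (rule runs_Seq)
      fix m2 assume m2: "frame {20, 21} m1 m2 \<and> frame ?S m m2 \<and>
        written ((w @ replicate n True) @ [False]) m2"
      then have "IU 0 m2" by (simp add: IU_def)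
      from loopU[OF this] show "runs (For 11 (Var 2) (For 12 (Var 2) ?body)) m2
        (graph_time n - (n * (2 + 2) + 2) - 2) (\<lambda>m'. frame ?S m m' \<and> written (w @ graph_bits h) m')"
      proof (rule runs_weaken)
        show "n * ((n * ((n * 8 + 12) + 2) + 2) + 2) + 2 \<le> graph_time n - (n * (2 + 2) + 2) - 2"
          by (simp add: graph_time_def algebra_simps)
      qed (simp add: IU_def graph_bits_eq)
    qed (simp add: graph_time_def)
  qed (simp add: graph_time_def)
qed

definition block_bits :: "nat \<Rightarrow> bool list list" where
  "block_bits s = map graph_bits (code_heights k s (best_code c G k s))"

definition written_graphs :: "bool list list \<Rightarrow> memory \<Rightarrow> bool" where
  "written_graphs ws m \<longleftrightarrow> written (concat ws) m \<and> m 22 0 = length ws"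

lemma runs_Block:
  assumes m: "ready m" "m 6 = (\<lambda>_. 0)" "m 8 0 = s" "written_graphs ws m" and s: "s < n"
  shows "runs (Block c) m (block_time n k) (\<lambda>m'. ready m' \<and> m' 6 = (\<lambda>_. 0) \<and> m' 8 0 = s + k \<and>
    written_graphs (ws @ block_bits s) m')"
proof -
  let ?N = "best_code c G k s"
  let ?K = "?N div Suc k ^ (k * k)"
  let ?m = "m(7 := (m 7)(0 := 0))"
  have K: "?K \<le> k" by (rule best_code_count[OF k_pos])
  have "frame {7} m ?m" by (simp add: frame_def)
  then have rdy: "ready ?m" by (rule ready_frame[OF m(1)]) simp
  \<comment> \<open>An empty bank 6 and count 0 are the code 0, from which the search
    starts.\<close>
  have "coded s 0 ?m" using m(2,3) by (simp add: coded_def digit_def)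
  note search = runs_Search[OF rdy this s]
  have emit: "runs (For 13 (Var 7) (EmitGraph c)) m1 (?K * (graph_time n + 2) + 2)
      (\<lambda>m'. frame {11, 12, 13, 14, 15, 16, 20, 21} m1 m' \<and>
        written (concat ws @ concat (map (\<lambda>j. graph_bits (code_height k s ?N j)) [0..<?K])) m')"
    if m1: "ready m1" "coded s ?N m1" "written (concat ws) m1" for m1
  proof (rule runs_For)
    let ?S = "{11, 12, 13, 14, 15, 16, 20, 21}"
    let ?w = "\<lambda>i. concat ws @ concat (map (\<lambda>j. graph_bits (code_height k s ?N j)) [0..<i])"
    let ?I = "\<lambda>i m'. frame ?S m1 m' \<and> written (?w i) m'"
    show "?I 0 (m1(13 := (m1 13)(0 := 0)))" using m1(3) by (auto simp: frame_def written_def)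
    show "eval_expr (Var 7) m' = ?K" if "?I i m'" for i m'
      using that m1(2) by (simp add: frame_def coded_def)
    fix i m' assume i: "i < ?K" and I: "?I i m'" and mi: "m' 13 0 = i"
    have rdy': "ready m'" by (rule ready_frame[OF m1(1)]) (use I in auto)
    have "coded s ?N m'" by (rule coded_cong[OF m1(2)]) (use I in \<open>auto simp: frame_def\<close>)
    then have "\<forall>v<n. m' 6 (v * k + m' 13 0) = code_height k s ?N i v"
      using coded_height i K mi by auto
    from runs_EmitGraph[OF rdy' this]
    have "runs (EmitGraph c) m' (graph_time n) (\<lambda>m''. frame {11, 12, 14, 15, 16, 20, 21} m' m'' \<and>
        written (?w i @ graph_bits (code_height k s ?N i)) m'')" using I by blast
    then show "runs (EmitGraph c) m' (graph_time n)
        (\<lambda>m'. m' 13 0 = i \<and> ?I (Suc i) (m'(13 := (m' 13)(0 := Suc i))))"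
    proof (rule runs_weaken)
      fix m2 assume m2: "frame {11, 12, 14, 15, 16, 20, 21} m' m2 \<and>
        written (?w i @ graph_bits (code_height k s ?N i)) m2"
      have "frame ?S m1 m2" by (rule frame_trans[of _ _ m']) (use I m2 in auto)
      then have "frame ?S m1 (m2(13 := (m2 13)(0 := Suc i)))" by (rule frame_update) simp
      moreover have "written (?w (Suc i)) (m2(13 := (m2 13)(0 := Suc i)))"
        using m2 by (simp add: written_def)
      moreover have "m2 13 = m' 13" using m2 by (simp add: frame_def)
      ultimately show "m2 13 0 = i \<and> ?I (Suc i) (m2(13 := (m2 13)(0 := Suc i)))"
        using mi by simp
    qed simp
  qed
  have clear: "runs (For 19 (Var 10) (Assign 6 (Plus (Cell 5 (Var 8)) (Var 19)) (Const 0))) m1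
      (k * k * 3 + 2) (\<lambda>m'. frame {6, 19} m1 m' \<and> m' 6 = (\<lambda>_. 0))"
    if m1: "ready m1" "m1 8 0 = s"
      "\<And>q. q < s * k \<or> s * k + k * k \<le> q \<Longrightarrow> m1 6 q = 0" for m1
  proof -
    let ?I = "\<lambda>i m'. frame {6, 19} m1 m' \<and> (\<forall>q. q < s * k + i \<or> s * k + k * k \<le> q \<longrightarrow> m' 6 q = 0)"
    have "runs (For 19 (Var 10) (Assign 6 (Plus (Cell 5 (Var 8)) (Var 19)) (Const 0))) m1
      (k * k * (1 + 2) + 2) (?I (k * k))"
    proof (rule runs_For[where I = ?I])
      show "?I 0 (m1(19 := (m1 19)(0 := 0)))" using m1(3) by (auto simp: frame_def)
      show "eval_expr (Var 10) m' = k * k" if "?I i m'" for i m'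
        using that m1(1) by (simp add: frame_def ready_def)
      fix i m' assume i: "i < k * k" and I: "?I i m'" and mi: "m' 19 0 = i"
      have "m' 5 = m1 5" "m' 8 = m1 8" using I by (auto simp: frame_def)
      then have "eval_expr (Plus (Cell 5 (Var 8)) (Var 19)) m' = s * k + i"
        using m1(1,2) mi s by (simp add: ready_def)
      then show "runs (Assign 6 (Plus (Cell 5 (Var 8)) (Var 19)) (Const 0)) m' 1
        (\<lambda>m'. m' 19 0 = i \<and> ?I (Suc i) (m'(19 := (m' 19)(0 := Suc i))))"
        unfolding runs_Assign using I mi by (auto simp: frame_def)
    qed
    then show ?thesis
    proof (rule runs_weaken)
      show "k * k * (1 + 2) + 2 \<le> k * k * 3 + 2" by (simp only: one_plus_numeral num.simps add_num_simps)
    qed (auto simp: fun_eq_iff not_le)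
  qed
  let ?bits = "concat (map (\<lambda>j. graph_bits (code_height k s ?N j)) [0..<?K])"
  have bits: "concat (block_bits s) = ?bits" "length (block_bits s) = ?K"
    by (simp_all add: block_bits_def code_heights_def o_def)
  let ?Q = "\<lambda>m'. ready m' \<and> m' 6 = (\<lambda>_. 0) \<and> m' 8 0 = s + k \<and> written_graphs (ws @ block_bits s) m'"
  have 4: "runs (Seq (For 19 (Var 10) (Assign 6 (Plus (Cell 5 (Var 8)) (Var 19)) (Const 0)))
     (Set 8 (Plus (Var 8) (Var 3)))) m1 (k * k * 3 + 3) ?Q"
    if m1: "ready m1" "m1 8 0 = s" "\<And>q. q < s * k \<or> s * k + k * k \<le> q \<Longrightarrow> m1 6 q = 0"
      "written_graphs (ws @ block_bits s) m1" for m1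
  proof (rule runs_Seq[OF clear[OF m1(1-3)]])
    fix m2 assume m2: "frame {6, 19} m1 m2 \<and> m2 6 = (\<lambda>_. 0)"
    have rdy2: "ready m2" by (rule ready_frame[OF m1(1)]) (use m2 in auto)
    have "m2 8 = m1 8" "m2 20 = m1 20" "m2 21 = m1 21" "m2 22 = m1 22"
      using m2 by (auto simp: frame_def)
    then show "runs (Set 8 (Plus (Var 8) (Var 3))) m2 (k * k * 3 + 3 - (k * k * 3 + 2)) ?Q"
      using rdy2 m2 m1(2,4) by (simp add: ready_def written_graphs_def written_def)
  next
    show "k * k * 3 + 2 \<le> k * k * 3 + 3" by simp
  qed
  have 3: "runs (Seq (Set 22 (Plus (Var 22) (Var 7))) (Seq
     (For 19 (Var 10) (Assign 6 (Plus (Cell 5 (Var 8)) (Var 19)) (Const 0)))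
     (Set 8 (Plus (Var 8) (Var 3))))) m1 (k * k * 3 + 4) ?Q"
    if m1: "ready m1" "coded s ?N m1" "written (concat ws @ ?bits) m1" "m1 22 0 = length ws" for m1
  proof -
    let ?m1 = "m1(22 := (m1 22)(0 := m1 22 0 + m1 7 0))"
    have "runs (Seq (For 19 (Var 10) (Assign 6 (Plus (Cell 5 (Var 8)) (Var 19)) (Const 0)))
       (Set 8 (Plus (Var 8) (Var 3)))) ?m1 (k * k * 3 + 3) ?Q"
    proof (rule 4)
      show "ready ?m1" using m1(1) by (simp add: ready_def)
      show "written_graphs (ws @ block_bits s) ?m1"
        using m1(2-4) bits by (simp add: written_graphs_def written_def coded_def)
    qed (use m1(2) in \<open>auto simp: coded_def\<close>)
    then show ?thesis
      unfolding runs_Seq_Assign eval_expr.simps by (intro conjI) (simp, erule runs_weaken, auto)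
  qed
  show ?thesis
    unfolding Block_def runs_Seq_Assign eval_expr.simps
  proof (intro conjI runs_Seq[OF search])
    fix m1 assume m1: "frame {6, 7, 11, 12, 13, 14, 15, 17, 18, 19} ?m m1 \<and> coded s ?N m1"
    have m1': "m1 20 = m 20" "m1 21 = m 21" "m1 22 = m 22"
      using m1 by (auto simp: frame_def)
    have rdy1: "ready m1" by (rule ready_frame[OF rdy]) (use m1 in auto)
    have w1: "written (concat ws) m1"
      using m(4) m1' by (simp add: written_graphs_def written_def)
    show "runs (Seq (For 13 (Var 7) (EmitGraph c)) (Seq (Set 22 (Plus (Var 22) (Var 7))) (Seq
     (For 19 (Var 10) (Assign 6 (Plus (Cell 5 (Var 8)) (Var 19)) (Const 0)))
     (Set 8 (Plus (Var 8) (Var 3)))))) m1 (block_time n k - 1 - search_time n k) ?Q"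
    proof (rule runs_Seq[OF emit[OF rdy1 _ w1]])
      show "coded s ?N m1" using m1 by simp
      have le: "?K * (graph_time n + 2) \<le> k * (graph_time n + 2)" using K by (rule mult_le_mono1)
      then show "?K * (graph_time n + 2) + 2 \<le> block_time n k - 1 - search_time n k"
        by (simp add: block_time_def)
      fix m2 assume m2: "frame {11, 12, 13, 14, 15, 16, 20, 21} m1 m2 \<and>
        written (concat ws @ ?bits) m2"
      have "runs (Seq (Set 22 (Plus (Var 22) (Var 7))) (Seq
       (For 19 (Var 10) (Assign 6 (Plus (Cell 5 (Var 8)) (Var 19)) (Const 0)))
       (Set 8 (Plus (Var 8) (Var 3))))) m2 (k * k * 3 + 4) ?Q"
      proof (rule 3)
        show "ready m2" by (rule ready_frame[OF rdy1]) (use m2 in auto)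
        show "coded s ?N m2"
          by (rule coded_cong[of s ?N m1]) (use m1 m2 in \<open>auto simp: frame_def\<close>)
        show "m2 22 0 = length ws"
          using m2 m1' m(4) by (simp add: frame_def written_graphs_def)
      qed (use m2 in simp)
      then show "runs (Seq (Set 22 (Plus (Var 22) (Var 7))) (Seq
       (For 19 (Var 10) (Assign 6 (Plus (Cell 5 (Var 8)) (Var 19)) (Const 0)))
       (Set 8 (Plus (Var 8) (Var 3))))) m2
       (block_time n k - 1 - search_time n k - (?K * (graph_time n + 2) + 2)) ?Q"
        by (rule runs_weaken) (use le in \<open>auto simp: block_time_def\<close>)
    qed
  qed (simp_all add: block_time_def)
qed

end

lemma runs_BlockSize:
  assumes n: "m 2 0 = n"
  shows "runs BlockSize m (size_time n)
    (\<lambda>m'. frame {3, 11, 12, 13, 14, 15, 16} m m' \<and> m' 3 0 = block_size n)"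
proof -
  let ?S = "{3, 11, 12, 13, 14, 15, 16}"
  let ?T = "(n + 1) * 3 + 2"
  let ?acc = "For 14 (Plus (Var 11) (Const 2)) (Set 16 (Plus (Var 16) (Var 15)))"
  let ?mul = "Seq (Set 16 (Const 0)) (Seq ?acc (Set 15 (Var 16)))"
  define I where "I = (\<lambda>u x m'. frame ?S m m' \<and> m' 11 0 = u \<and> m' 3 0 = size_below n u \<and> m' 15 0 = x)"
  \<comment> \<open>Adding \<open>u + 2\<close> times multiplies cell 15 by \<open>u + 2\<close>.
    The loops in \<open>row\<close> and \<open>rows\<close> repeat this until the exponent
    \<open>Suc u * Suc u\<close> is reached; the bounds replace \<open>u + 1\<close> by
    \<open>n\<close>.\<close>
  have mul: "runs ?mul m1 (?T + 2) (\<lambda>m'. I u (Suc (Suc u) * x) m' \<and> m' 12 = m1 12 \<and> m' 13 = m1 13)"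
    if m1: "I u x m1" and u: "u < n" for u x m1
  proof -
    let ?J = "\<lambda>i m'. I u x m' \<and> m' 12 = m1 12 \<and> m' 13 = m1 13 \<and> m' 16 0 = i * x"
    let ?m1 = "m1(16 := (m1 16)(0 := 0))"
    have "runs ?acc ?m1 ((u + 2) * (1 + 2) + 2) (?J (u + 2))"
    proof (rule runs_For[where I = ?J])
      show "?J 0 (?m1(14 := (?m1 14)(0 := 0)))" using m1 by (auto simp: I_def frame_def)
    qed (auto simp: I_def frame_def)
    then have "runs ?acc ?m1 ?T (?J (u + 2))" by (rule runs_weaken) (use u in auto)
    then have "runs (Seq ?acc (Set 15 (Var 16))) ?m1 (?T + 1)
        (\<lambda>m'. I u (Suc (Suc u) * x) m' \<and> m' 12 = m1 12 \<and> m' 13 = m1 13)"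
      by (rule runs_Seq) (auto simp: I_def frame_def)
    then show ?thesis
      unfolding runs_Seq_Assign eval_expr.simps by (intro conjI) (simp, erule runs_weaken, auto)
  qed
  have row: "runs (For 13 (Plus (Var 11) (Const 1)) ?mul) m1 (n * (?T + 4) + 2)
      (\<lambda>m'. I u (Suc (Suc u) ^ Suc u * x) m' \<and> m' 12 = m1 12)"
    if m1: "I u x m1" and u: "u < n" for u x m1
  proof -
    let ?J = "\<lambda>i m'. I u (Suc (Suc u) ^ i * x) m' \<and> m' 12 = m1 12"
    have "runs (For 13 (Plus (Var 11) (Const 1)) ?mul) m1 (Suc u * ((?T + 2) + 2) + 2) (?J (Suc u))"
    proof (rule runs_For[where I = ?J])
      show "?J 0 (m1(13 := (m1 13)(0 := 0)))" using m1 by (auto simp: I_def frame_def)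
      show "eval_expr (Plus (Var 11) (Const 1)) m' = Suc u" if "?J i m'" for i m'
        using that by (simp add: I_def)
      fix i m' assume J: "?J i m'" and mi: "m' 13 0 = i"
      from J have "I u (Suc (Suc u) ^ i * x) m'" by simp
      from mul[OF this u] show "runs ?mul m' (?T + 2)
          (\<lambda>m'. m' 13 0 = i \<and> ?J (Suc i) (m'(13 := (m' 13)(0 := Suc i))))"
        by (rule runs_weaken) (use J mi in \<open>auto simp: I_def frame_def mult_ac\<close>)
    qed
    then show ?thesis
    proof (rule runs_weaken)
      have "Suc u * ((?T + 2) + 2) \<le> n * (?T + 4)" by (rule mult_le_mono) (use u in auto)
      then show "Suc u * ((?T + 2) + 2) + 2 \<le> n * (?T + 4) + 2" by simp
    qed
  qed
  have rows: "runs (For 12 (Plus (Var 11) (Const 1)) (For 13 (Plus (Var 11) (Const 1)) ?mul)) m1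
      (n * (n * (?T + 4) + 4) + 2) (\<lambda>m'. I u (Suc (Suc u) ^ (Suc u * Suc u)) m')"
    if m1: "I u 1 m1" and u: "u < n" for u m1
  proof -
    let ?J = "\<lambda>i m'. I u (Suc (Suc u) ^ (i * Suc u)) m'"
    have "runs (For 12 (Plus (Var 11) (Const 1)) (For 13 (Plus (Var 11) (Const 1)) ?mul)) m1
        (Suc u * ((n * (?T + 4) + 2) + 2) + 2) (?J (Suc u))"
    proof (rule runs_For[where I = ?J])
      show "?J 0 (m1(12 := (m1 12)(0 := 0)))" using m1 by (auto simp: I_def frame_def)
      show "eval_expr (Plus (Var 11) (Const 1)) m' = Suc u" if "?J i m'" for i m'
        using that by (simp add: I_def)
      fix i m' assume J: "?J i m'" and mi: "m' 12 0 = i"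
      have pow: "Suc (Suc u) ^ Suc u * Suc (Suc u) ^ (i * Suc u) = Suc (Suc u) ^ (Suc i * Suc u)"
        by (simp only: mult_Suc power_add)
      from row[OF J u, unfolded pow] show "runs (For 13 (Plus (Var 11) (Const 1)) ?mul) m' (n * (?T + 4) + 2)
          (\<lambda>m'. m' 12 0 = i \<and> ?J (Suc i) (m'(12 := (m' 12)(0 := Suc i))))"
        by (rule runs_weaken) (use mi in \<open>auto simp: I_def frame_def\<close>)
    qed
    then show ?thesis
    proof (rule runs_weaken)
      have "Suc u * ((n * (?T + 4) + 2) + 2) \<le> n * (n * (?T + 4) + 4)"
        by (rule mult_le_mono) (use u in auto)
      then show "Suc u * ((n * (?T + 4) + 2) + 2) + 2 \<le> n * (n * (?T + 4) + 4) + 2" by simp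
    qed
  qed
  let ?pow = "For 12 (Plus (Var 11) (Const 1)) (For 13 (Plus (Var 11) (Const 1)) ?mul)"
  let ?step = "Seq (Set 15 (Const 1)) (Seq ?pow
      (If (Le (Var 15) (Var 2)) (Set 3 (Plus (Var 11) (Const 1))) Skip))"
  let ?TR = "n * (n * (?T + 4) + 4) + 2"
  let ?J = "\<lambda>i m'. frame ?S m m' \<and> m' 3 0 = size_below n i"
  let ?m = "m(3 := (m 3)(0 := 1))"
  have "runs (For 11 (Var 2) ?step) ?m (n * ((?TR + 3) + 2) + 2) (?J n)"
  proof (rule runs_For[where I = ?J])
    show "?J 0 (?m(11 := (?m 11)(0 := 0)))" by (auto simp: frame_def)
    show "eval_expr (Var 2) m' = n" if "?J i m'" for i m'
      using that n by (simp add: frame_def)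
    fix u m' assume u: "u < n" and J: "?J u m'" and mu: "m' 11 0 = u"
    let ?m' = "m'(15 := (m' 15)(0 := 1))"
    let ?Q = "\<lambda>m'. m' 11 0 = u \<and> ?J (Suc u) (m'(11 := (m' 11)(0 := Suc u)))"
    have "I u 1 ?m'" using J mu by (auto simp: I_def frame_def)
    from rows[OF this u] have "runs (Seq ?pow
        (If (Le (Var 15) (Var 2)) (Set 3 (Plus (Var 11) (Const 1))) Skip)) ?m' (?TR + 2) ?Q"
    proof (rule runs_Seq)
      fix m2 assume I2: "I u (Suc (Suc u) ^ (Suc u * Suc u)) m2"
      have "runs (If (Le (Var 15) (Var 2)) (Set 3 (Plus (Var 11) (Const 1))) Skip) m2 (1 + 1) ?Q"
      proof (rule runs_If_of_bool[where P = "Suc (Suc u) ^ (Suc u * Suc u) \<le> n"])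
        show "eval_expr (Le (Var 15) (Var 2)) m2 = of_bool (Suc (Suc u) ^ (Suc u * Suc u) \<le> n)"
          using I2 n by (simp add: I_def frame_def del: mult_Suc power_Suc)
        assume *: "Suc (Suc u) ^ (Suc u * Suc u) \<le> n"
        then have "size_below n (Suc u) = Suc u" by (simp only: size_below.simps if_True)
        then show "runs (Set 3 (Plus (Var 11) (Const 1))) m2 1 ?Q"
          using I2 by (auto simp: I_def frame_def simp del: size_below.simps)
      next
        assume *: "\<not> Suc (Suc u) ^ (Suc u * Suc u) \<le> n"
        then have "size_below n (Suc u) = size_below n u" by (simp only: size_below.simps if_False)
        then show "runs Skip m2 1 ?Q"
          using I2 by (auto simp: I_def frame_def simp del: size_below.simps)
      qed
      then show "runs (If (Le (Var 15) (Var 2)) (Set 3 (Plus (Var 11) (Const 1))) Skip) m2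
          (?TR + 2 - ?TR) ?Q"
        by (rule runs_weaken) auto
    qed simp
    then show "runs ?step m' (?TR + 3) ?Q"
      unfolding runs_Seq_Assign eval_expr.simps by (intro conjI) (simp, erule runs_weaken, auto)
  qed
  then show ?thesis
    unfolding BlockSize_def runs_Seq_Assign eval_expr.simps block_size_def
    by (intro conjI) (simp add: size_time_def, erule runs_weaken, auto simp: size_time_def algebra_simps)
qed

section \<open>Initialisation, output and the whole program\<close>

lemma nth_concat_map_upt:
  assumes "i < b" "j < a"
  shows "concat (map (\<lambda>i. map (f i) [0..<a]) [0..<b]) ! (i * a + j) = f i j"
  using assms(1)
proof (induction b)
  case (Suc b)
  show ?case
  proof (cases "i = b")
    case True
    then show ?thesis using assms(2) by (simp add: nth_append length_concat_map_upt)
  next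
    case False
    then have "i < b" using Suc.prems by simp
    then have "(i + 1) * a \<le> b * a" by (intro mult_right_mono) auto
    then have "i * a + j < b * a" using assms(2) by simp
    then show ?thesis using Suc.IH[OF \<open>i < b\<close>] by (simp add: nth_append length_concat_map_upt)
  qed
qed simp

lemma length_concat_uniform:
  "\<forall>w\<in>set ws. length w = l \<Longrightarrow> length (concat ws) = length ws * l"
  by (induction ws) auto

text \<open>The output overwrites the input in bank 0. Input bits may survive behind it, which is
  harmless because \<open>holds_output\<close> inspects only the cells below the stored
  length.\<close>

lemma runs_Output:
  assumes m: "written (concat ws) m" "m 22 0 = length ws"
  shows "runs Output m (length ws * 3 + length (concat ws) * 3 + 6)
    (\<lambda>m'. holds_output m' (replicate (length ws) True @ [False] @ concat ws))"
proof -
  let ?c = "length ws" and ?l = "length (concat ws)"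
  define I where "I = (\<lambda>i m'. frame {0, 11} m m' \<and> (\<forall>q<i. m' 0 q = 1))"
  define J where "J = (\<lambda>i m'. frame {0, 11} m m' \<and> (\<forall>q<?c. m' 0 q = 1) \<and> m' 0 ?c = 0 \<and>
      (\<forall>q<i. m' 0 (?c + 1 + q) = of_bool (concat ws ! q)))"
  have l: "m 21 0 = ?l" "\<And>i. i < ?l \<Longrightarrow> m 20 i = of_bool (concat ws ! i)"
    using m(1) by (auto simp: written_def)
  have ones: "runs (For 11 (Var 22) (Assign 0 (Var 11) (Const 1))) m (?c * (1 + 2) + 2) (I ?c)"
  proof (rule runs_For)
    show "I 0 (m(11 := (m 11)(0 := 0)))" by (auto simp: I_def frame_def)
    show "eval_expr (Var 22) m' = ?c" if "I i m'" for i m'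
      using that m by (simp add: I_def frame_def)
    show "runs (Assign 0 (Var 11) (Const 1)) m' 1
        (\<lambda>m'. m' 11 0 = i \<and> I (Suc i) (m'(11 := (m' 11)(0 := Suc i))))"
      if "I i m'" "m' 11 0 = i" for i m'
      using that by (auto simp: I_def frame_def less_Suc_eq)
  qed
  have copy: "runs (For 11 (Var 21) (Assign 0 (Plus (Plus (Var 22) (Const 1)) (Var 11)) (Cell 20 (Var 11))))
      m1 (?l * (1 + 2) + 2) (J ?l)" if "J 0 m1" for m1
  proof (rule runs_For)
    show "J 0 (m1(11 := (m1 11)(0 := 0)))" using that by (auto simp: J_def frame_def)
    show "eval_expr (Var 21) m' = ?l" if "J i m'" for i m'
      using that l by (simp add: J_def frame_def)
    fix i m' assume i: "i < ?l" and I: "J i m'" and mi: "m' 11 0 = i"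
    have "m' 20 = m 20" "m' 22 = m 22" using I by (auto simp: J_def frame_def)
    then have "eval_expr (Plus (Plus (Var 22) (Const 1)) (Var 11)) m' = ?c + 1 + i"
      "eval_expr (Cell 20 (Var 11)) m' = of_bool (concat ws ! i)"
      using m(2) l(2)[OF i] mi by simp_all
    then show "runs (Assign 0 (Plus (Plus (Var 22) (Const 1)) (Var 11)) (Cell 20 (Var 11))) m' 1
        (\<lambda>m'. m' 11 0 = i \<and> J (Suc i) (m'(11 := (m' 11)(0 := Suc i))))"
      unfolding runs_Assign using I mi by (auto simp: J_def frame_def less_Suc_eq)
  qed
  have holds: "holds_output m' (replicate ?c True @ [False] @ concat ws)"
    if "J ?l m1" "m' 0 = m1 0" "m' 1 0 = ?c + 1 + ?l" for m1 m'
    unfolding holds_output_def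
  proof (intro conjI allI impI)
    show "m' 1 0 = length (replicate ?c True @ [False] @ concat ws)" using that(3) by simp
    fix i assume i: "i < length (replicate ?c True @ [False] @ concat ws)"
    consider "i < ?c" | "i = ?c" | q where "i = ?c + 1 + q" "q < ?l"
    proof -
      have "\<exists>q. i = ?c + 1 + q \<and> q < ?l" if "?c < i"
        using that i by (intro exI[of _ "i - ?c - 1"]) auto
      then show thesis using that linorder_less_linear by blast
    qed
    then show "m' 0 i = of_bool ((replicate ?c True @ [False] @ concat ws) ! i)"
      by cases (use that in \<open>auto simp: J_def nth_append\<close>)
  qed
  show ?thesis
    unfolding Output_def
  proof (rule runs_Seq[OF ones])
    show "?c * (1 + 2) + 2 \<le> ?c * 3 + ?l * 3 + 6" by simp
    fix m1 assume I1: "I ?c m1"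
    let ?m1 = "m1(0 := (m1 0)(?c := 0))"
    have "J 0 ?m1" using I1 by (auto simp: I_def J_def frame_def)
    from copy[OF this]
    have "runs (Seq (For 11 (Var 21) (Assign 0 (Plus (Plus (Var 22) (Const 1)) (Var 11)) (Cell 20 (Var 11))))
        (Set 1 (Plus (Plus (Var 22) (Const 1)) (Var 21)))) ?m1 (?l * 3 + 3)
        (\<lambda>m'. holds_output m' (replicate ?c True @ [False] @ concat ws))"
    proof (rule runs_Seq)
      show "?l * (1 + 2) + 2 \<le> ?l * 3 + 3" by simp
      fix m2 assume J2: "J ?l m2"
      have "m2 21 = m 21" "m2 22 = m 22" using J2 by (auto simp: J_def frame_def)
      then show "runs (Set 1 (Plus (Plus (Var 22) (Const 1)) (Var 21))) m2
          (?l * 3 + 3 - (?l * (1 + 2) + 2))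
          (\<lambda>m'. holds_output m' (replicate ?c True @ [False] @ concat ws))"
        unfolding runs_Assign using m(2) l(1) by (intro conjI holds[OF J2]) simp_all
    qed
    moreover have "eval_expr (Var 22) m1 = ?c" using I1 m(2) by (simp add: I_def frame_def)
    ultimately show "runs (Seq (Assign 0 (Var 22) (Const 0)) (Seq
        (For 11 (Var 21) (Assign 0 (Plus (Plus (Var 22) (Const 1)) (Var 11)) (Cell 20 (Var 11))))
        (Set 1 (Plus (Plus (Var 22) (Const 1)) (Var 21))))) m1
        (?c * 3 + ?l * 3 + 6 - (?c * (1 + 2) + 2))
        (\<lambda>m'. holds_output m' (replicate ?c True @ [False] @ concat ws))"
      unfolding runs_Seq_Assign by (intro conjI) (simp, simp only: eval_expr.simps(1), erule runs_weaken, auto)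
  qed
qed

context labelled_graph
begin

lemma input_memory_encode_graph:
  shows "i < n \<Longrightarrow> input_memory (encode_graph G) 0 i = 1"
    and "input_memory (encode_graph G) 0 n = 0"
    and "w < n \<Longrightarrow> v < n \<Longrightarrow>
      input_memory (encode_graph G) 0 (n + 1 + w * n + v) = of_bool ({w, v} \<in> edges G)"
    and "2 \<le> a \<Longrightarrow> input_memory (encode_graph G) a = (\<lambda>_. 0)"
    and "length (encode_graph G) = n + 1 + n * n"
proof -
  let ?e = "\<lambda>w v. {w, v} \<in> edges G"
  let ?M = "concat (map (\<lambda>w. map (?e w) [0..<n]) [0..<n])"
  have e: "encode_graph G = replicate n True @ [False] @ ?M"
    by (simp add: encode_graph_def card_verts)
  show len: "length (encode_graph G) = n + 1 + n * n"
    by (simp add: e length_concat_map_upt)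
  show "i < n \<Longrightarrow> input_memory (encode_graph G) 0 i = 1"
    unfolding input_memory_def len by (simp add: e nth_append)
  show "input_memory (encode_graph G) 0 n = 0"
    unfolding input_memory_def len by (simp add: e nth_append)
  show "2 \<le> a \<Longrightarrow> input_memory (encode_graph G) a = (\<lambda>_. 0)"
    by (auto simp: input_memory_def fun_eq_iff)
  assume wv: "w < n" "v < n"
  have "(w + 1) * n \<le> n * n" using wv by (intro mult_right_mono) auto
  then have "n + 1 + w * n + v < n + 1 + n * n" using wv by simp
  moreover have "encode_graph G ! (n + 1 + w * n + v) = ?e w v"
    using nth_concat_map_upt[OF wv, of ?e] by (simp add: e nth_append)
  ultimately show "input_memory (encode_graph G) 0 (n + 1 + w * n + v) = of_bool (?e w v)"
    unfolding input_memory_def len by simp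
qed

lemma runs_Init:
  assumes k: "k = block_size n"
  shows "runs Init (input_memory (encode_graph G)) (init_time n k)
    (\<lambda>m. ready m \<and> m 6 = (\<lambda>_. 0) \<and> m 8 0 = 0 \<and> written_graphs [] m)"
proof -
  let ?m = "input_memory (encode_graph G)"
  let ?S = "{2, 3, 4, 5, 10, 11, 12, 13, 14, 15, 16, 23}"
  note inp = input_memory_encode_graph
  let ?Q = "\<lambda>m. ready m \<and> m 6 = (\<lambda>_. 0) \<and> m 8 0 = 0 \<and> written_graphs [] m"
  \<comment> \<open>The frame includes bank 10, which the last loop changes. That it is still 0
    before then is therefore carried along separately.\<close>
  define R where "R = (\<lambda>m. frame ?S ?m m \<and> m 2 0 = n \<and> m 3 0 = k)"
  have count: "runs (While (Cell 0 (Var 2)) (Inc 2)) ?m (n * (1 + 1) + 1)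
      (\<lambda>m'. frame {2} ?m m' \<and> m' 2 0 = n)"
  proof (rule runs_While[where I = "\<lambda>i m'. frame {2} ?m m' \<and> m' 2 0 = i"])
    fix i m' assume "i < n" "frame {2} ?m m' \<and> m' 2 0 = i"
    then show "eval_expr (Cell 0 (Var 2)) m' \<noteq> 0" by (simp add: frame_def inp)
  qed (auto simp: frame_def inp)
  have rows: "runs (For 11 (Var 2) (Seq (Assign 4 (Var 11) (Var 23)) (Set 23 (Plus (Var 23) (Var 2)))))
      m1 (n * (2 + 2) + 2) (\<lambda>m'. R m' \<and> (\<forall>w<n. m' 4 w = n + 1 + w * n) \<and> m' 10 = (\<lambda>_. 0))"
    if m1: "R m1" "m1 23 0 = n + 1" "m1 10 = (\<lambda>_. 0)" for m1
  proof -
    let ?I = "\<lambda>i m'. R m' \<and> m' 23 0 = n + 1 + i * n \<and> (\<forall>w<i. m' 4 w = n + 1 + w * n) \<and>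
        m' 10 = (\<lambda>_. 0)"
    have "runs (For 11 (Var 2) (Seq (Assign 4 (Var 11) (Var 23)) (Set 23 (Plus (Var 23) (Var 2)))))
      m1 (n * (2 + 2) + 2) (?I n)"
    proof (rule runs_For[where I = ?I])
      show "?I 0 (m1(11 := (m1 11)(0 := 0)))" using m1 by (auto simp: R_def frame_def)
    qed (auto simp: R_def frame_def less_Suc_eq)
    then show ?thesis by (rule runs_weaken) auto
  qed
  have cols: "runs (For 11 (Var 2) (Seq (Assign 5 (Var 11) (Var 23)) (Set 23 (Plus (Var 23) (Var 3)))))
      m1 (n * (2 + 2) + 2)
      (\<lambda>m'. R m' \<and> (\<forall>w<n. m' 4 w = n + 1 + w * n) \<and> (\<forall>v<n. m' 5 v = v * k) \<and> m' 10 = (\<lambda>_. 0))"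
    if m1: "R m1" "\<forall>w<n. m1 4 w = n + 1 + w * n" "m1 23 0 = 0" "m1 10 = (\<lambda>_. 0)" for m1
  proof -
    let ?I = "\<lambda>i m'. R m' \<and> (\<forall>w<n. m' 4 w = n + 1 + w * n) \<and> m' 10 = (\<lambda>_. 0) \<and>
        m' 23 0 = i * k \<and> (\<forall>v<i. m' 5 v = v * k)"
    have "runs (For 11 (Var 2) (Seq (Assign 5 (Var 11) (Var 23)) (Set 23 (Plus (Var 23) (Var 3)))))
      m1 (n * (2 + 2) + 2) (?I n)"
    proof (rule runs_For[where I = ?I])
      show "?I 0 (m1(11 := (m1 11)(0 := 0)))" using m1 by (auto simp: R_def frame_def)
    qed (auto simp: R_def frame_def less_Suc_eq)
    then show ?thesis by (rule runs_weaken) auto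
  qed
  have square: "runs (For 11 (Var 3) (Set 10 (Plus (Var 10) (Var 3)))) m1 (k * (1 + 2) + 2) ?Q"
    if m1: "R m1" "\<forall>w<n. m1 4 w = n + 1 + w * n" "\<forall>v<n. m1 5 v = v * k" "m1 10 = (\<lambda>_. 0)" for m1
  proof -
    let ?I = "\<lambda>i m'. R m' \<and> (\<forall>w<n. m' 4 w = n + 1 + w * n) \<and> (\<forall>v<n. m' 5 v = v * k) \<and>
        m' 10 0 = i * k"
    have "runs (For 11 (Var 3) (Set 10 (Plus (Var 10) (Var 3)))) m1 (k * (1 + 2) + 2) (?I k)"
    proof (rule runs_For[where I = ?I])
      show "?I 0 (m1(11 := (m1 11)(0 := 0)))" using m1 by (auto simp: R_def frame_def)
    qed (auto simp: R_def frame_def)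
    then show ?thesis
    proof (rule runs_weaken)
      fix m2 assume I: "?I k m2"
      then have fr: "m2 0 = ?m 0" "m2 6 = ?m 6" "m2 8 = ?m 8" "m2 20 = ?m 20" "m2 21 = ?m 21" "m2 22 = ?m 22"
        by (auto simp: R_def frame_def)
      have "ready m2"
        unfolding ready_def using I inp(3) by (auto simp: fr R_def)
      then show "?Q m2" using inp(4) by (simp add: fr written_graphs_def written_def)
    qed simp
  qed
  have 4: "runs (Seq (Set 23 (Const 0)) (Seq
     (For 11 (Var 2) (Seq (Assign 5 (Var 11) (Var 23)) (Set 23 (Plus (Var 23) (Var 3)))))
     (For 11 (Var 3) (Set 10 (Plus (Var 10) (Var 3)))))) m1 (n * 4 + k * 3 + 5) ?Q"
    if m1: "R m1" "\<forall>w<n. m1 4 w = n + 1 + w * n" "m1 10 = (\<lambda>_. 0)" for m1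
    unfolding runs_Seq_Assign eval_expr.simps
  proof (intro conjI)
    show "runs (Seq (For 11 (Var 2) (Seq (Assign 5 (Var 11) (Var 23)) (Set 23 (Plus (Var 23) (Var 3)))))
     (For 11 (Var 3) (Set 10 (Plus (Var 10) (Var 3))))) (m1(23 := (m1 23)(0 := 0)))
     (n * 4 + k * 3 + 5 - 1) ?Q"
    proof (rule runs_Seq[OF cols])
      fix m2 assume "R m2 \<and> (\<forall>w<n. m2 4 w = n + 1 + w * n) \<and> (\<forall>v<n. m2 5 v = v * k) \<and> m2 10 = (\<lambda>_. 0)"
      then show "runs (For 11 (Var 3) (Set 10 (Plus (Var 10) (Var 3)))) m2
          (n * 4 + k * 3 + 5 - 1 - (n * (2 + 2) + 2)) ?Q"
        by (intro runs_weaken[OF square]) auto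
    qed (use m1 in \<open>auto simp: R_def frame_def\<close>)
  qed simp
  have 3: "runs (Seq (Set 23 (Plus (Var 2) (Const 1))) (Seq
     (For 11 (Var 2) (Seq (Assign 4 (Var 11) (Var 23)) (Set 23 (Plus (Var 23) (Var 2))))) (Seq
     (Set 23 (Const 0)) (Seq
     (For 11 (Var 2) (Seq (Assign 5 (Var 11) (Var 23)) (Set 23 (Plus (Var 23) (Var 3)))))
     (For 11 (Var 3) (Set 10 (Plus (Var 10) (Var 3)))))))) m1 (n * 8 + k * 3 + 8) ?Q"
    if m1: "R m1" "m1 10 = (\<lambda>_. 0)" for m1
    unfolding runs_Seq_Assign[of 23 _ "Plus (Var 2) (Const 1)"]
  proof (intro conjI)
    let ?m1 = "m1(23 := (m1 23)(eval_expr (Const 0) m1 := eval_expr (Plus (Var 2) (Const 1)) m1))"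
    let ?rows = "For 11 (Var 2) (Seq (Assign 4 (Var 11) (Var 23)) (Set 23 (Plus (Var 23) (Var 2))))"
    have "R ?m1" "?m1 23 0 = n + 1" "?m1 10 = (\<lambda>_. 0)" using m1 by (auto simp: R_def frame_def)
    from rows[OF this] show "runs (Seq ?rows (Seq
     (Set 23 (Const 0)) (Seq
     (For 11 (Var 2) (Seq (Assign 5 (Var 11) (Var 23)) (Set 23 (Plus (Var 23) (Var 3)))))
     (For 11 (Var 3) (Set 10 (Plus (Var 10) (Var 3))))))) ?m1 (n * 8 + k * 3 + 8 - 1) ?Q"
    proof (rule runs_Seq)
      fix m2 assume "R m2 \<and> (\<forall>w<n. m2 4 w = n + 1 + w * n) \<and> m2 10 = (\<lambda>_. 0)"
      then show "runs (Seq (Set 23 (Const 0)) (Seq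
         (For 11 (Var 2) (Seq (Assign 5 (Var 11) (Var 23)) (Set 23 (Plus (Var 23) (Var 3)))))
         (For 11 (Var 3) (Set 10 (Plus (Var 10) (Var 3)))))) m2
         (n * 8 + k * 3 + 8 - 1 - (n * (2 + 2) + 2)) ?Q"
        by (intro runs_weaken[OF 4]) auto
    qed simp
  qed simp
  show ?thesis
    unfolding Init_def
  proof (rule runs_Seq[OF count])
    fix m1 assume m1: "frame {2} ?m m1 \<and> m1 2 0 = n"
    from m1 have "runs BlockSize m1 (size_time n)
        (\<lambda>m'. frame {3, 11, 12, 13, 14, 15, 16} m1 m' \<and> m' 3 0 = block_size n)"
      by (intro runs_BlockSize) simp
    then
    show "runs (Seq BlockSize (Seq (Set 23 (Plus (Var 2) (Const 1))) (Seq
     (For 11 (Var 2) (Seq (Assign 4 (Var 11) (Var 23)) (Set 23 (Plus (Var 23) (Var 2))))) (Seq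
     (Set 23 (Const 0)) (Seq
     (For 11 (Var 2) (Seq (Assign 5 (Var 11) (Var 23)) (Set 23 (Plus (Var 23) (Var 3)))))
     (For 11 (Var 3) (Set 10 (Plus (Var 10) (Var 3))))))))) m1 (init_time n k - (n * (1 + 1) + 1)) ?Q"
    proof (rule runs_Seq)
      fix m2 assume m2: "frame {3, 11, 12, 13, 14, 15, 16} m1 m2 \<and> m2 3 0 = block_size n"
      have "R m2" "m2 10 = (\<lambda>_. 0)"
        using m1 m2 inp(4)[of 10] by (auto simp: R_def frame_def k)
      then show "runs (Seq (Set 23 (Plus (Var 2) (Const 1))) (Seq
        (For 11 (Var 2) (Seq (Assign 4 (Var 11) (Var 23)) (Set 23 (Plus (Var 23) (Var 2))))) (Seq
        (Set 23 (Const 0)) (Seq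
        (For 11 (Var 2) (Seq (Assign 5 (Var 11) (Var 23)) (Set 23 (Plus (Var 23) (Var 3)))))
        (For 11 (Var 3) (Set 10 (Plus (Var 10) (Var 3)))))))) m2
        (init_time n k - (n * (1 + 1) + 1) - size_time n) ?Q"
        by (intro runs_weaken[OF 3]) (auto simp: init_time_def)
    qed (simp add: init_time_def)
  qed (simp add: init_time_def)
qed

text \<open>The main loop compares the start \<open>i * k\<close> of the next block with
  \<open>n\<close>; the two facts say that it makes exactly \<open>block_count n\<close>
  passes.\<close>

lemma block_count_bounds:
  assumes k: "k = block_size n"
  shows "i < block_count n \<Longrightarrow> i * k < n" and "n \<le> block_count n * k"
proof -
  have bc: "block_count n = (n + k - 1) div k" by (simp add: block_count_def k)
  have "(n + k - 1) div k * k + (n + k - 1) mod k = n + k - 1" by simp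
  moreover have "(n + k - 1) mod k < k" using k_pos by simp
  ultimately show "n \<le> block_count n * k" unfolding bc using k_pos by linarith
  assume "i < block_count n"
  then have "Suc i \<le> (n + k - 1) div k" by (simp add: bc)
  then have "Suc i * k \<le> n + k - 1" using k_pos by (simp add: less_eq_div_iff_mult_less_eq)
  then show "i * k < n" using k_pos by simp
qed

text \<open>The length of the output is subtracted from the budget so that adding it back gives the
  quantity in \<open>poly_time_computable_on\<close>; the second claim ensures that this subtraction
  does not truncate.\<close>

lemma runs_Main:
  assumes k: "k = block_size n"
  shows "runs (Main c) (input_memory (encode_graph G))
    (main_time n k - length (encode_graphs (representation c G)))
    (\<lambda>m. holds_output m (encode_graphs (representation c G)))"
    and "length (encode_graphs (representation c G)) \<le> main_time n k"
proof -
  let ?ws = "\<lambda>i. concat (map (\<lambda>i. block_bits (i * k)) [0..<i])"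
  let ?M = "block_count n"
  let ?I = "\<lambda>i m. ready m \<and> m 6 = (\<lambda>_. 0) \<and> m 8 0 = i * k \<and> written_graphs (?ws i) m"
  let ?out = "encode_graphs (representation c G)"
  have bits: "?ws ?M = map encode_graph (representation c G)"
    unfolding representation_def all_heights_def card_verts Let_def k[symmetric]
    by (simp add: map_concat block_bits_def o_def graph_bits_def[abs_def])
  have out: "?out = replicate (length (?ws ?M)) True @ [False] @ concat (?ws ?M)"
    unfolding bits encode_graphs_def by simp
  have len: "length (?ws ?M) \<le> ?M * k"
  proof -
    have "length (?ws i) \<le> i * k" for i
    proof (induction i)
      case (Suc i)
      have "length (block_bits (i * k)) \<le> k"
        using best_code_count[OF k_pos] by (simp add: block_bits_def code_heights_def)
      then show ?case using Suc by simp
    qed simp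
    then show ?thesis .
  qed
  have len2: "length (concat (?ws ?M)) = length (?ws ?M) * (n + 1 + n * n)"
  proof -
    have "\<forall>w\<in>set (?ws ?M). length w = n + 1 + n * n"
      by (auto simp: block_bits_def length_graph_bits)
    then show ?thesis by (rule length_concat_uniform)
  qed
  have blocks: "runs (While (Less (Var 8) (Var 2)) (Block c)) m1 (?M * (block_time n k + 1) + 1) (?I ?M)"
    if "?I 0 m1" for m1
  proof (rule runs_While[where I = ?I])
    show "?I 0 m1" by (rule that)
  next
    fix i m assume i: "i < ?M" and I: "?I i m"
    have ik: "i * k < n" by (rule block_count_bounds(1)[OF k i])
    show "eval_expr (Less (Var 8) (Var 2)) m \<noteq> 0" using I ik by (simp add: ready_def)
    from I have "ready m" "m 6 = (\<lambda>_. 0)" "m 8 0 = i * k" "written_graphs (?ws i) m" by simp_all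
    from runs_Block[OF this ik] show "runs (Block c) m (block_time n k) (?I (Suc i))"
      by (rule runs_weaken) (auto simp: add.commute)
  next
    fix m assume "?I ?M m"
    then show "eval_expr (Less (Var 8) (Var 2)) m = 0"
      using block_count_bounds(2)[OF k] by (simp add: ready_def)
  qed
  let ?T = "init_time n k + (?M * (block_time n k + 1) + 1) +
      (length (?ws ?M) * 3 + length (concat (?ws ?M)) * 3 + 6)"
  have run: "runs (Main c) (input_memory (encode_graph G)) ?T (\<lambda>m. holds_output m ?out)"
    unfolding Main_def
  proof (rule runs_Seq[OF runs_Init[OF k]])
    fix m1 assume m1: "ready m1 \<and> m1 6 = (\<lambda>_. 0) \<and> m1 8 0 = 0 \<and> written_graphs [] m1"
    have "?I 0 m1" using m1 by simp
    from blocks[OF this]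
    show "runs (Seq (While (Less (Var 8) (Var 2)) (Block c)) Output) m1 (?T - init_time n k)
        (\<lambda>m. holds_output m ?out)"
    proof (rule runs_Seq)
      fix m2 assume I: "?I ?M m2"
      then have "written (concat (?ws ?M)) m2" "m2 22 0 = length (?ws ?M)"
        by (simp_all add: written_graphs_def)
      from runs_Output[OF this, folded out]
      show "runs Output m2 (?T - init_time n k - (?M * (block_time n k + 1) + 1)) (\<lambda>m. holds_output m ?out)"
        by (rule runs_weaken) auto
    qed simp
  qed simp
  have lo: "length ?out = length (?ws ?M) + 1 + length (concat (?ws ?M))"
    unfolding out by simp
  have "?T + length ?out \<le> main_time n k"
  proof -
    have "length (?ws ?M) * ((n + 1 + n * n) * 4 + 4) \<le> (?M * k) * ((n + 1 + n * n) * 4 + 4)"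
      using len by (rule mult_le_mono1)
    moreover have "length (?ws ?M) * ((n + 1 + n * n) * 4 + 4) =
        length (?ws ?M) * 4 + length (concat (?ws ?M)) * 4"
      unfolding len2 by (simp add: algebra_simps)
    ultimately show ?thesis unfolding lo main_time_def by linarith
  qed
  then show "length ?out \<le> main_time n k"
    and "runs (Main c) (input_memory (encode_graph G)) (main_time n k - length ?out) (\<lambda>m. holds_output m ?out)"
    using runs_weaken[OF run, of "main_time n k - length ?out" "\<lambda>m. holds_output m ?out"] by auto
qed

end

section \<open>Approximation factor and running time\<close>

lemma size_below_cases: "size_below n i = 1 \<or> Suc (size_below n i) ^ (size_below n i * size_below n i) \<le> n"
proof (induction i)
  case (Suc i)
  then show ?case by (cases "Suc (Suc i) ^ (Suc i * Suc i) \<le> n") (simp_all only: size_below.simps if_True if_False simp_thms)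
qed simp

lemma size_below_le: "size_below n i \<le> max 1 i"
proof (induction i)
  case (Suc i)
  have "size_below n (Suc i) = Suc i \<or> size_below n (Suc i) = size_below n i"
    by (simp only: size_below.simps split: if_split) simp
  then show ?case using Suc by (elim disjE) linarith+
qed simp

lemma size_below_maximal:
  assumes "size_below n i < j" "j \<le> i"
  shows "n < Suc j ^ (j * j)"
  using assms
proof (induction i)
  case (Suc i)
  show ?case
  proof (cases "Suc (Suc i) ^ (Suc i * Suc i) \<le> n")
    case True
    then have "size_below n (Suc i) = Suc i" by (simp only: size_below.simps if_True)
    then show ?thesis using Suc.prems by simp
  next
    case False
    then have eq: "size_below n (Suc i) = size_below n i" by (simp only: size_below.simps if_False)
    show ?thesis
    proof (cases "j = Suc i")
      case True
      then show ?thesis using False by (simp only: not_le)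
    next
      case False
      then show ?thesis using Suc.IH Suc.prems eq by simp
    qed
  qed
qed simp

lemma block_size_le: "block_size n \<le> n + 1"
  using size_below_le[of n n] by (simp add: block_size_def)

text \<open>The added 2 accounts for the default size 1, where the power is 2 whatever
  \<open>n\<close> is.\<close>

lemma block_size_power_le: "Suc (block_size n) ^ (block_size n * block_size n) \<le> n + 2"
  using size_below_cases[of n n] by (auto simp: block_size_def)

text \<open>As the block size is below \<open>n\<close>, its successor was among the tested
  candidates and failed. This failure is what later forces the block size to be large.\<close>

lemma less_block_size_power:
  assumes "2 \<le> n"
  shows "n < Suc (Suc (block_size n)) ^ (Suc (block_size n) * Suc (block_size n))"
    and "block_size n < n"
proof -
  let ?k = "block_size n"
  show lt: "?k < n"
  proof (cases "?k = 1")
    case False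
    then have "Suc ?k ^ (?k * ?k) \<le> n" using size_below_cases[of n n] by (simp add: block_size_def)
    moreover have "Suc ?k ^ 1 \<le> Suc ?k ^ (?k * ?k)"
      using block_size_pos[of n] by (intro power_increasing) auto
    ultimately show ?thesis by simp
  qed (use assms in simp)
  show "n < Suc (Suc ?k) ^ (Suc ?k * Suc ?k)"
    by (rule size_below_maximal[of _ n]) (use lt in \<open>auto simp: block_size_def\<close>)
qed

text \<open>Write \<open>L = ln n\<close> and \<open>M = ln L\<close>. Since the candidate
  \<open>k + 1\<close> failed, \<open>L < (k + 1)^2 * ln (k + 2)\<close>. If
  \<open>4 * k < sqrt L / sqrt M\<close>, then \<open>k + 2 <= L\<close>, so the right-hand side is
  at most \<open>4 * k^2 * M\<close>, whereas squaring the assumption gives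
  \<open>16 * k^2 * M < L\<close>.\<close>

lemma block_size_ge:
  assumes "2 \<le> n" "1 \<le> ln (ln (real n))"
  shows "sqrt (ln (real n)) / sqrt (ln (ln (real n))) \<le> 4 * real (block_size n)"
proof (rule ccontr)
  define k where "k = real (block_size n)"
  define L where "L = ln (real n)"
  define M where "M = ln L"
  have M: "1 \<le> M" using assms(2) by (simp add: M_def L_def)
  have "0 < L" using assms(1) by (simp add: L_def)
  have "exp 1 \<le> L" using M \<open>0 < L\<close> by (simp add: M_def ln_ge_iff)
  then have L: "1 \<le> L" using exp_ge_add_one_self[of "1::real"] by linarith
  have k1: "1 \<le> k" using block_size_pos[of n] by (simp add: k_def)
  assume "\<not> ?thesis"
  then have lt: "4 * k < sqrt L / sqrt M" by (simp add: k_def L_def M_def)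
  have "sqrt L / sqrt M \<le> sqrt L / 1" using M L by (intro divide_left_mono) auto
  also have "\<dots> \<le> L" using L by (simp add: real_le_lsqrt power2_eq_square mult_le_cancel_left1)
  finally have kL: "k + 2 \<le> L" using lt k1 by simp
  have "(4 * k)\<^sup>2 < (sqrt L / sqrt M)\<^sup>2" using lt k1 by (intro power_strict_mono) auto
  then have "16 * k\<^sup>2 < L / M" using L M by (simp add: power_divide power_mult_distrib)
  then have sq: "16 * k\<^sup>2 * M < L" using M by (simp add: pos_less_divide_eq)
  have "real n < real (Suc (Suc (block_size n)) ^ (Suc (block_size n) * Suc (block_size n)))"
    using less_block_size_power(1)[OF assms(1)] by (simp only: of_nat_less_iff)
  also have "\<dots> = (k + 2) ^ (Suc (block_size n) * Suc (block_size n))"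
    by (simp add: k_def add.commute del: mult_Suc power_Suc)
  finally have "L < ln ((k + 2) ^ (Suc (block_size n) * Suc (block_size n)))"
    using assms(1) by (simp add: L_def del: mult_Suc power_Suc)
  also have "\<dots> = real (Suc (block_size n) * Suc (block_size n)) * ln (k + 2)"
    by (rule ln_realpow)
  also have "\<dots> = (k + 1)\<^sup>2 * ln (k + 2)"
    by (simp add: k_def power2_eq_square algebra_simps)
  also have "\<dots> \<le> (2 * k)\<^sup>2 * M"
    using k1 kL by (intro mult_mono power_mono) (auto simp: M_def)
  also have "\<dots> \<le> 16 * k\<^sup>2 * M"
    using M by (simp add: power_mult_distrib mult_right_mono)
  finally show False using sq by simp
qed

text \<open>From \<open>(k + 1) ^ (k * k) <= n\<close> follows
  \<open>k * k * ln (k + 1) <= ln n\<close>, and the logarithm on the left is at least 1 for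
  \<open>k >= 2\<close>. The crude bound suffices to make the number of binary digits of
  \<open>k\<close> of order \<open>ln (ln n)\<close>.\<close>

lemma block_size_upper:
  assumes "2 \<le> n" "1 \<le> ln (ln (real n))"
  shows "real (block_size n) \<le> ln (real n)"
proof -
  have pos: "0 < ln (real n)" using assms(1) by simp
  have "exp 1 \<le> ln (real n)" using assms(2) pos by (simp add: ln_ge_iff)
  then have one: "1 \<le> ln (real n)" using exp_ge_add_one_self[of "1::real"] by linarith
  let ?k = "block_size n"
  show ?thesis
  proof (cases "?k = 1")
    case False
    then have "Suc ?k ^ (?k * ?k) \<le> n" using size_below_cases[of n n] by (simp add: block_size_def)
    then have "real (Suc ?k ^ (?k * ?k)) \<le> real n" by (simp only: of_nat_le_iff)
    then have "ln (real (Suc ?k) ^ (?k * ?k)) \<le> ln (real n)" using assms(1) by (subst ln_le_cancel_iff) auto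
    then have le: "real (?k * ?k) * ln (real (Suc ?k)) \<le> ln (real n)" by (simp add: ln_realpow)
    have k2: "2 \<le> ?k" using False block_size_pos[of n] by simp
    have "exp 1 \<le> real (Suc ?k)" using k2 exp_le by simp
    then have "1 \<le> ln (real (Suc ?k))" by (subst ln_ge_iff) auto
    then have "real (?k * ?k) * 1 \<le> real (?k * ?k) * ln (real (Suc ?k))" by (intro mult_left_mono) auto
    moreover have "real ?k \<le> real (?k * ?k)" using k2 by simp
    ultimately show ?thesis using le by linarith
  qed (use one in simp)
qed

lemma block_count_le:
  assumes "2 \<le> n"
  shows "real (block_count n) \<le> 2 * real n / real (block_size n)"
proof -
  let ?k = "block_size n"
  have k: "0 < ?k" "?k < n" using block_size_pos less_block_size_power(2)[OF assms] by auto
  have "block_count n * ?k \<le> n + ?k - 1" by (simp add: block_count_def)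
  then have "block_count n * ?k \<le> 2 * n" using k by linarith
  then have "real (block_count n * ?k) \<le> real (2 * n)" by (simp only: of_nat_le_iff)
  then show ?thesis using k by (simp add: pos_le_divide_eq)
qed

text \<open>The 8 is the 2 from rounding up in \<open>block_count_le\<close> times the 4 of
  \<open>block_size_ge\<close>.\<close>

lemma block_count_le_sqrt:
  assumes "2 \<le> n" "1 \<le> ln (ln (real n))"
  shows "real (block_count n) \<le> 8 * (real n * sqrt (ln (ln (real n))) / sqrt (ln (real n)))"
proof -
  define a where "a = sqrt (ln (real n))"
  define b where "b = sqrt (ln (ln (real n)))"
  have a: "0 < a" using assms(1) by (simp add: a_def)
  have b: "0 < b" using assms(2) by (simp add: b_def)
  have k: "0 < real (block_size n)" using block_size_pos by simp
  have "a / b \<le> 4 * real (block_size n)" using block_size_ge[OF assms] by (simp add: a_def b_def)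
  then have "a \<le> 4 * real (block_size n) * b" using b by (simp add: pos_divide_le_eq)
  then have "1 / real (block_size n) \<le> 4 * b / a" using a k by (simp add: field_simps)
  then have "2 * real n * (1 / real (block_size n)) \<le> 2 * real n * (4 * b / a)"
    by (intro mult_left_mono) auto
  then show ?thesis using block_count_le[OF assms(1)] by (simp add: a_def b_def)
qed

lemma eventually_ln_ln: "\<forall>\<^sub>F n in sequentially. 2 \<le> n \<and> 1 \<le> ln (ln (real n))"
proof -
  have "filterlim (\<lambda>n. ln (ln (real n))) at_top sequentially"
    by (intro filterlim_compose[OF ln_at_top] filterlim_real_sequentially)
  then have "\<forall>\<^sub>F n in sequentially. 1 \<le> ln (ln (real n))" by (simp add: filterlim_at_top)
  then show ?thesis using eventually_ge_at_top[of "2::nat"] by eventually_elim simp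
qed

lemma block_count_bigo:
  "(\<lambda>n. 2 * real (block_count n)) \<in> O(\<lambda>n. real n * sqrt (ln (ln (real n))) / sqrt (ln (real n)))"
proof (rule bigoI[of _ 16])
  show "\<forall>\<^sub>F n in sequentially. norm (2 * real (block_count n)) \<le>
      16 * norm (real n * sqrt (ln (ln (real n))) / sqrt (ln (real n)))"
    using eventually_ln_ln
  proof eventually_elim
    case (elim n)
    then have "0 \<le> ln (ln (real n))" by linarith
    then have "0 \<le> real n * sqrt (ln (ln (real n))) / sqrt (ln (real n))"
      using elim by (intro divide_nonneg_nonneg mult_nonneg_nonneg real_sqrt_ge_zero) auto
    then show ?case using block_count_le_sqrt[of n] elim
      by (simp only: real_norm_def abs_of_nonneg) simp
  qed
qed

text \<open>Rounding and the extra digit cost at most 2, which \<open>1 <= ln (ln n)\<close>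
  absorbs; passing from base 2 to the natural logarithm costs a factor 2 because
  \<open>ln 2 >= 1/2\<close>.\<close>

lemma bit_length_block_size_le:
  assumes "2 \<le> n" "1 \<le> ln (ln (real n))"
  shows "real (bit_length (block_size n)) \<le> 4 * ln (ln (real n))"
proof -
  let ?k = "real (block_size n)"
  have k: "1 \<le> ?k" using block_size_pos[of n] by simp
  have "0 \<le> log 2 ?k" using k by simp
  then have "real (bit_length (block_size n)) \<le> log 2 ?k + 2"
    unfolding bit_length_def by linarith
  also have "log 2 ?k \<le> 2 * ln (ln (real n))"
  proof -
    have "1 \<le> ln ((2::real) ^ 2)" using exp_le by (subst ln_ge_iff) auto
    then have ln2: "1 / 2 \<le> ln (2::real)" using ln_realpow[of 2 2] by simp
    have "ln ?k \<le> ln (ln (real n))" using block_size_upper[OF assms] k by simp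
    also have "\<dots> \<le> 2 * ln (ln (real n)) * ln 2" using ln2 assms(2) by (simp add: mult_le_cancel_left1)
    finally show ?thesis by (simp add: log_def pos_divide_le_eq)
  qed
  also have "2 * ln (ln (real n)) + 2 \<le> 4 * ln (ln (real n))" using assms(2) by simp
  finally show ?thesis by simp
qed

lemma block_count_bit_length_bigo:
  "(\<lambda>n. 4 * real (block_count n) * real (bit_length (block_size n))) \<in>
     O(\<lambda>n. real n * ln (ln (real n)) powr (3 / 2) / sqrt (ln (real n)))"
\<comment> \<open>The 128 is the explicit factor 4 times the 8 of the block count and the 4 of the
  bit length.\<close>
proof (rule bigoI[of _ 128])
  show "\<forall>\<^sub>F n in sequentially. norm (4 * real (block_count n) * real (bit_length (block_size n))) \<le>
      128 * norm (real n * ln (ln (real n)) powr (3 / 2) / sqrt (ln (real n)))"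
    using eventually_ln_ln
  proof eventually_elim
    case (elim n)
    let ?L = "ln (ln (real n))"
    have L: "0 \<le> ?L" using elim by linarith
    have "?L powr (3 / 2) = ?L powr (1 / 2) * ?L powr 1"
      by (simp only: powr_add[symmetric]) simp
    then have pw: "?L powr (3 / 2) = sqrt ?L * ?L"
      by (simp only: powr_half_sqrt[OF L] powr_one[OF L])
    have "real (block_count n) * real (bit_length (block_size n)) \<le>
        8 * (real n * sqrt ?L / sqrt (ln (real n))) * (4 * ?L)"
      using block_count_le_sqrt[of n] bit_length_block_size_le[of n] elim
      by (intro mult_mono) auto
    moreover have "8 * (real n * sqrt ?L / sqrt (ln (real n))) * (4 * ?L) =
        32 * (real n * ?L powr (3 / 2) / sqrt (ln (real n)))"
      unfolding pw by simp
    moreover have "0 \<le> real n * ?L powr (3 / 2) / sqrt (ln (real n))"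
      using elim by simp
    ultimately show ?case by (simp only: real_norm_def abs_of_nonneg) simp
  qed
qed

section \<open>Polynomial bounds on the running time\<close>

definition poly_bounded :: "(nat \<Rightarrow> nat) \<Rightarrow> bool" where
  "poly_bounded f \<longleftrightarrow> (\<exists>p :: nat poly. \<forall>x. f x \<le> poly p x)"

lemma poly_bounded_const: "poly_bounded (\<lambda>x. a)"
  unfolding poly_bounded_def by (rule exI[of _ "[:a:]"]) simp

lemma poly_bounded_ident: "poly_bounded (\<lambda>x. x)"
  unfolding poly_bounded_def by (rule exI[of _ "[:0, 1:]"]) simp

lemma poly_bounded_add: "poly_bounded f \<Longrightarrow> poly_bounded g \<Longrightarrow> poly_bounded (\<lambda>x. f x + g x)"
  unfolding poly_bounded_def by (metis add_mono poly_add)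

lemma poly_bounded_mult: "poly_bounded f \<Longrightarrow> poly_bounded g \<Longrightarrow> poly_bounded (\<lambda>x. f x * g x)"
  unfolding poly_bounded_def by (metis mult_le_mono poly_mult)

text \<open>Coefficients are natural numbers. This turns a bound in \<open>n\<close> into one in the
  input length, which is at least \<open>n\<close>.\<close>

lemma poly_nat_mono:
  fixes p :: "nat poly"
  assumes "x \<le> y"
  shows "poly p x \<le> poly p y"
  by (induction p) (use assms in \<open>auto intro!: add_mono mult_le_mono\<close>)

lemma poly_bounded_mono: "poly_bounded g \<Longrightarrow> (\<And>x. f x \<le> g x) \<Longrightarrow> poly_bounded f"
  unfolding poly_bounded_def by (meson le_trans)

lemma poly_bounded_Suc: "poly_bounded f \<Longrightarrow> poly_bounded (\<lambda>x. Suc (f x))"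
  using poly_bounded_add[OF _ poly_bounded_const[of 1]] by simp

lemma poly_bounded_main_time: "poly_bounded (\<lambda>n. main_time n (block_size n))"
proof -
  have k: "poly_bounded block_size"
    by (rule poly_bounded_mono[OF poly_bounded_add[OF poly_bounded_ident poly_bounded_const[of 1]]])
      (rule block_size_le)
  \<comment> \<open>Here the choice of the block size pays off: the number of candidate codes is
    linear in \<open>n\<close> up to the factor \<open>k + 1\<close>.\<close>
  have pow: "poly_bounded (\<lambda>n. Suc (block_size n) ^ (block_size n * block_size n))"
    by (rule poly_bounded_mono[OF poly_bounded_add[OF poly_bounded_ident poly_bounded_const[of 2]]])
      (rule block_size_power_le)
  have "block_count n \<le> n + block_size n" for n
    unfolding block_count_def using div_le_dividend le_trans diff_le_self by blast
  then have count: "poly_bounded block_count"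
    by (rule poly_bounded_mono[OF poly_bounded_add[OF poly_bounded_ident k]])
  show ?thesis
    unfolding main_time_def block_time_def init_time_def search_time_def graph_time_def
      check_time_def size_time_def
    by (intro poly_bounded_add poly_bounded_mult k pow count poly_bounded_Suc
        poly_bounded_ident poly_bounded_const)
qed

lemma poly_time_representation:
  "poly_time_computable_on labelled_graphs encode_graph encode_graphs (representation c)"
proof -
  obtain p where p: "\<And>n. main_time n (block_size n) \<le> poly p n"
    using poly_bounded_main_time unfolding poly_bounded_def by blast
  show ?thesis
    unfolding poly_time_computable_on_def
  proof (rule exI[of _ "Main c"], rule exI[of _ p], rule ballI)
    fix G assume G: "G \<in> labelled_graphs"
    define n where "n = card (verts G)"
    interpret labelled_graph c G n "block_size n"
      by unfold_locales (use G block_size_pos in \<open>auto simp: n_def\<close>)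
    let ?out = "encode_graphs (representation c G)"
    obtain t m where t: "exec (Main c) (input_memory (encode_graph G)) t m" "holds_output m ?out"
        "t \<le> main_time n (block_size n) - length ?out"
      using runs_Main(1)[OF refl] unfolding runs_def by blast
    have "t + length ?out \<le> main_time n (block_size n)" using t(3) runs_Main(2)[OF refl] by simp
    also have "\<dots> \<le> poly p n" by (rule p)
    also have "\<dots> \<le> poly p (length (encode_graph G))"
      by (rule poly_nat_mono) (simp add: input_memory_encode_graph(5))
    finally show "\<exists>k m. exec (Main c) (input_memory (encode_graph G)) k m \<and> holds_output m ?out \<and>
        k + length ?out \<le> poly p (length (encode_graph G))"
      using t(1,2) by blast
  qed
qed

theorem theorem3:
  "(\<exists>(A :: nat graph \<Rightarrow> nat graph list) (t :: nat \<Rightarrow> real).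
      poly_time_computable_on labelled_graphs encode_graph encode_graphs A \<and>
      t \<in> O(\<lambda>n. real n * sqrt (ln (ln (real n))) / sqrt (ln (real n))) \<and>
      (\<forall>G\<in>labelled_graphs.
         box_representation G (A G) \<and>
         real (length (A G)) \<le> t (card (verts G)) * real (boxicity G))) \<and>
   (\<exists>(A' :: nat graph \<Rightarrow> nat graph list) (t' :: nat \<Rightarrow> real).
      poly_time_computable_on labelled_graphs encode_graph encode_graphs A' \<and>
      t' \<in> O(\<lambda>n. real n * ln (ln (real n)) powr (3 / 2) / sqrt (ln (real n))) \<and>
      (\<forall>G\<in>labelled_graphs.
         cube_representation G (A' G) \<and>
         real (length (A' G)) \<le> t' (card (verts G)) * real (cubicity G)))"
proof (rule conjI, goal_cases)
  case 1
  show ?case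
  proof (rule exI[of _ "representation False"], rule exI[of _ "\<lambda>n. 2 * real (block_count n)"],
      intro conjI ballI poly_time_representation block_count_bigo box_representation_representation)
    fix G assume "G \<in> labelled_graphs"
    then have "real (length (representation False G)) \<le>
        real (block_count (card (verts G)) * (2 * boxicity G))"
      using length_representation_boxicity by (simp only: of_nat_le_iff)
    then show "real (length (representation False G)) \<le>
        2 * real (block_count (card (verts G))) * real (boxicity G)"
      by (simp add: mult_ac)
  qed
next
  case 2
  show ?case
  proof (rule exI[of _ "representation True"],
      rule exI[of _ "\<lambda>n. 4 * real (block_count n) * real (bit_length (block_size n))"],
      intro conjI ballI poly_time_representation block_count_bit_length_bigo
        cube_representation_representation)
    fix G assume "G \<in> labelled_graphs"
    then have "real (length (representation True G)) \<le> real (block_count (card (verts G)) *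
        (4 * bit_length (block_size (card (verts G))) * cubicity G))"
      using length_representation_cubicity by (simp only: of_nat_le_iff)
    then show "real (length (representation True G)) \<le>
        4 * real (block_count (card (verts G))) *
          real (bit_length (block_size (card (verts G)))) * real (cubicity G)"
      by (simp add: mult_ac)
  qed
qed

end
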